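(* Suppose $A\in M_n$ and $1\le r<k\le n$. Let $\mathcal{S}$ be a subset of $\mathcal{F}_r$ containing the set $\mathcal{S}_0=\{2e^{i\xi}\|A\|P: P\in\mathcal{P}_r \text{ and } \xi\in[0,2\pi)\}$. Then (a) $\Lambda_k(A)=\bigcap\{\Lambda_{k-r}(A+F): F\in\mathcal{S}\}$; (b) $\Lambda_k(A)=\bigcap\{\Lambda_{k-1}(A+2e^{i\xi}\|A\|P): \xi\in[0,2\pi),\ P\in\mathcal{P}_1\}$; (c) $\Lambda_k(A)=\bigcap\{W(A+2e^{i\xi}\|A\|P): \xi\in[0,2\pi),\ P\in\mathcal{P}_{k-1}\}$.
   Context: $M_n$ is the algebra of $n\times n$ complex matrices, regarded as operators on $\mathbb{C}^n$, and $\|\cdot\|$ is the operator norm. $\mathcal{F}_r$ is the set of matrices in $M_n$ of rank at most $r$; $\mathcal{P}_r$ is the set of rank $r$ orthogonal projections in $M_n$. For $1\le m\le n$, $\Lambda_m(A)=\{\lambda\in\mathbb{C}: PAP=\lambda P\text{ for some rank-}m\text{ orthogonal projection }P\in M_n\}$. $W(A)=\{\langle Ax,x\rangle: x \in \mathbb{C}^n,\ \langle x,x\rangle=1\}=\Lambda_1(A)$. *)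

theory Defs
  imports "HOL-Analysis.Analysis"
begin

definition cinner_vec :: "complex^'n \<Rightarrow> complex^'n \<Rightarrow> complex" where
  "cinner_vec x y = (\<Sum>i\<in>UNIV. x $ i * cnj (y $ i))"

definition conj_transpose :: "complex^'n^'m \<Rightarrow> complex^'m^'n" where
  "conj_transpose A = map_matrix cnj (transpose A)"

definition scale_matrix :: "complex \<Rightarrow> complex^'n^'m \<Rightarrow> complex^'n^'m" where
  "scale_matrix c A = map_matrix (\<lambda>z. c * z) A"

(* The norm of complex^'n is the Euclidean one, so onorm gives the usual operator norm. *)
definition opnorm :: "complex^'n^'n \<Rightarrow> real" where
  "opnorm A = onorm (\<lambda>x. A *v x)"

definition rank_le_matrices :: "nat \<Rightarrow> (complex^'n^'n) set" where
  "rank_le_matrices r = {F. rank F \<le> r}"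

definition orth_projections :: "nat \<Rightarrow> (complex^'n^'n) set" where
  "orth_projections r = {P. P ** P = P \<and> conj_transpose P = P \<and> rank P = r}"

definition higher_rank_range :: "nat \<Rightarrow> complex^'n^'n \<Rightarrow> complex set" where
  "higher_rank_range m A =
     {c. \<exists>P \<in> orth_projections m. P ** A ** P = scale_matrix c P}"

definition num_range :: "complex^'n^'n \<Rightarrow> complex set" where
  "num_range A = {cinner_vec (A *v x) x | x. cinner_vec x x = 1}"

definition perturbation :: "complex^'n^'n \<Rightarrow> real \<Rightarrow> complex^'n^'n \<Rightarrow> complex^'n^'n" where
  "perturbation A \<xi> P =
     scale_matrix (2 * exp (\<i> * complex_of_real \<xi>) * complex_of_real (opnorm A)) P"

end

theory Submission
  imports Defs "HOL-Computational_Algebra.Fundamental_Theorem_Algebra"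
begin

text \<open>
  A number \<open>c\<close> lies in \<open>higher_rank_range m A\<close> exactly when
  the form \<open>\<langle>Ax, y\<rangle>\<close> equals \<open>c \<langle>x, y\<rangle>\<close> on some \<open>m\<close>-dimensional subspace
  (\<open>higher_rank_range_iff\<close>). A matrix \<open>F\<close> of rank at most \<open>r\<close> vanishes on a subspace of
  codimension at most \<open>r\<close>, so adding \<open>F\<close> to \<open>A\<close> costs at most \<open>r\<close> dimensions
  (\<open>higher_rank_range_perturb\<close>); this gives every inclusion of the left side in an
  intersection. In the other direction all three intersections are compared with the one in
  part (c): if \<open>c\<close> belongs to the rank \<open>k - r\<close> ranges of all the perturbations of
  \<open>A\<close> by rank \<open>r\<close> projections, then it belongs to the numerical ranges of all the perturbations
  by rank \<open>k - 1\<close> projections, because each of the latter agrees with one of the former on a large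
  subspace (\<open>num_range_of_higher_rank_range\<close>).

  So let \<open>c\<close> be in all numerical ranges of part (c), and put \<open>D = A - c I\<close>. For a unimodular
  \<open>w\<close>, suppose that the Hermitian part of \<open>w D\<close> had fewer than \<open>k\<close> nonnegative
  eigenvalues. Subtracting \<open>2 \<parallel>A\<parallel>\<close> times a spectral projection of rank \<open>k - 1\<close> pushes
  all eigenvalues below zero, and \<open>c\<close> would leave the numerical range of that perturbation. Hence the
  Hermitian part of \<open>w D\<close> is nonnegative on a \<open>k\<close>-dimensional subspace, for every \<open>w\<close>
  (\<open>nonneg_subspace_of_num_ranges\<close>).

  What remains is the theorem of Li and Sze: under this condition there is a single
  \<open>k\<close>-dimensional subspace on which the form of \<open>D\<close> vanishes
  (\<open>isotropic_subspace_exists\<close>). The proof is an induction on the dimension of a subspace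
  \<open>U\<close>. If \<open>U\<close> contains a nonzero vector \<open>x\<close> with \<open>\<langle>Dx, x\<rangle> = 0\<close> on which
  \<open>D\<close> and its adjoint induce proportional functionals, then \<open>x\<close> can be split off: passing to
  the quotient of the two-sided orthogonal of \<open>x\<close> by \<open>x\<close> lowers \<open>k\<close> by one
  (\<open>isotropic_eigenvector_reduction\<close>). If there is no such vector, the pencil of \<open>D\<close> and its
  adjoint is diagonalisable and the form is diagonal in some basis, with values \<open>z b\<close>
  (\<open>diagonalising_basis\<close>). The condition now says that every closed half-plane
  bounded by a line through the origin contains at least \<open>k\<close> of the points \<open>z b\<close>. Rotate so that the open right
  half-plane contains as few points as possible. The slopes of the points in the right half-plane
  then interlace those of the points in the left one (\<open>circle_configuration\<close>), and by the
  converse of Cauchy's interlacing theorem the diagonal matrix of the former slopes is a compression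
  of the diagonal matrix of the latter (\<open>interlacing_compression\<close>). The graph of the compressing
  isometry is the desired isotropic subspace (\<open>diagonal_isotropic\<close>).
\<close>

section \<open>The complex inner product, orthogonal complements and dimension\<close>

lemma cinner_add_left: "cinner_vec (x + y) z = cinner_vec x z + cinner_vec y z"
  by (simp add: cinner_vec_def sum.distrib algebra_simps)

lemma cinner_add_right: "cinner_vec x (y + z) = cinner_vec x y + cinner_vec x z"
  by (simp add: cinner_vec_def sum.distrib algebra_simps)

lemma cinner_scale_left: "cinner_vec (c *s x) y = c * cinner_vec x y"
  by (simp add: cinner_vec_def sum_distrib_left algebra_simps)

lemma cinner_scale_right: "cinner_vec x (c *s y) = cnj c * cinner_vec x y"
  by (simp add: cinner_vec_def sum_distrib_left algebra_simps)

lemma cinner_zero_left [simp]: "cinner_vec 0 y = 0"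
  and cinner_zero_right [simp]: "cinner_vec x 0 = 0"
  by (simp_all add: cinner_vec_def)

lemma cinner_diff_left: "cinner_vec (x - y) z = cinner_vec x z - cinner_vec y z"
  by (simp add: cinner_vec_def sum_subtractf algebra_simps)

lemma cinner_diff_right: "cinner_vec x (y - z) = cinner_vec x y - cinner_vec x z"
  by (simp add: cinner_vec_def sum_subtractf algebra_simps)

lemmas cinner_simps = cinner_add_left cinner_add_right cinner_scale_left cinner_scale_right
  cinner_diff_left cinner_diff_right

lemma cinner_sum_left: "cinner_vec (sum f I) y = (\<Sum>i\<in>I. cinner_vec (f i) y)"
  by (induction I rule: infinite_finite_induct) (auto simp: cinner_add_left)

lemma cinner_sum_right: "cinner_vec x (sum f I) = (\<Sum>i\<in>I. cinner_vec x (f i))"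
  by (induction I rule: infinite_finite_induct) (auto simp: cinner_add_right)

lemma cnj_cinner: "cnj (cinner_vec x y) = cinner_vec y x"
  by (simp add: cinner_vec_def mult.commute)

lemma cinner_eq_0_commute: "cinner_vec x y = 0 \<longleftrightarrow> cinner_vec y x = 0"
  by (metis cnj_cinner complex_cnj_zero)

lemma Re_cinner: "Re (cinner_vec x y) = x \<bullet> y"
  by (simp add: cinner_vec_def inner_vec_def inner_complex_def)

lemma cinner_self: "cinner_vec x x = of_real ((norm x)\<^sup>2)"
proof -
  have "Im (cinner_vec x x) = 0"
    by (simp add: cinner_vec_def)
  then show ?thesis
    by (simp add: complex_eq_iff Re_cinner power2_norm_eq_inner)
qed

lemma cinner_self_eq_0 [simp]: "cinner_vec x x = 0 \<longleftrightarrow> x = 0"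
  by (simp add: cinner_self)

lemma cinner_adjoint: "cinner_vec (A *v x) y = cinner_vec x (conj_transpose A *v y)"
proof -
  have "cinner_vec (A *v x) y = (\<Sum>i\<in>UNIV. \<Sum>j\<in>UNIV. A$i$j * x$j * cnj (y$i))"
    by (simp add: cinner_vec_def matrix_vector_mult_def sum_distrib_right)
  also have "\<dots> = (\<Sum>j\<in>UNIV. \<Sum>i\<in>UNIV. A$i$j * x$j * cnj (y$i))"
    by (rule sum.swap)
  also have "\<dots> = cinner_vec x (conj_transpose A *v y)"
    by (simp add: cinner_vec_def matrix_vector_mult_def sum_distrib_left conj_transpose_def
        map_matrix_def transpose_def mult_ac)
  finally show ?thesis .
qed

lemma conj_transpose_conj_transpose [simp]: "conj_transpose (conj_transpose A) = A"
  by (simp add: conj_transpose_def map_matrix_def transpose_def vec_eq_iff)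

lemma cinner_adjoint_left: "cinner_vec (conj_transpose A *v x) y = cnj (cinner_vec (A *v y) x)"
  by (metis cinner_adjoint cnj_cinner conj_transpose_conj_transpose)

lemma scale_matrix_vec: "scale_matrix c A *v x = c *s (A *v x)"
  by (simp add: scale_matrix_def map_matrix_def matrix_vector_mult_def vec_eq_iff
      sum_distrib_left mult.assoc)

lemma cinner_left_ext: "(\<And>y. cinner_vec x y = cinner_vec x' y) \<Longrightarrow> x = x'"
  by (metis cinner_diff_left cinner_self_eq_0 eq_iff_diff_eq_0)

lemma subspace_cinner_right: "vec.subspace {v. cinner_vec y v = 0}"
  by (auto simp: vec.subspace_def cinner_simps)
lemma cinner_span_right:
  assumes "y \<in> vec.span B" "\<And>b. b \<in> B \<Longrightarrow> cinner_vec v b = 0"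
  shows "cinner_vec v y = 0"
  using vec.span_minimal[OF _ subspace_cinner_right, of B v] assms by blast

lemma dim_Int_hyperplane:
  assumes "vec.subspace V"
  shows "vec.dim V \<le> vec.dim {v \<in> V. cinner_vec v y = 0} + 1"
proof (cases "\<forall>v\<in>V. cinner_vec v y = 0")
  case True
  then have "{v \<in> V. cinner_vec v y = 0} = V" by blast
  then show ?thesis by simp
next
  case False
  then obtain v0 where v0: "v0 \<in> V" "cinner_vec v0 y \<noteq> 0" by blast
  let ?W = "{v \<in> V. cinner_vec v y = 0}"
  have "V \<subseteq> vec.span (insert v0 ?W)"
  proof
    fix v assume "v \<in> V"
    let ?c = "cinner_vec v y / cinner_vec v0 y"
    have "v - ?c *s v0 \<in> ?W"
      using \<open>v \<in> V\<close> v0 assms by (auto simp: cinner_simps intro: vec.subspace_diff vec.subspace_scale)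
    then have "v - ?c *s v0 \<in> vec.span ?W" by (rule vec.span_base)
    then show "v \<in> vec.span (insert v0 ?W)" by (auto simp: vec.span_insert)
  qed
  then have "vec.dim V \<le> vec.dim (insert v0 ?W)"
    by (rule vec.dim_mono)
  also have "\<dots> \<le> vec.dim ?W + 1" by (simp add: vec.dim_insert)
  finally show ?thesis .
qed

text \<open>For the whole space \<open>V\<close> and a basis \<open>B\<close> of a subspace, this is the
  lower bound on the dimension of the orthogonal complement.\<close>
lemma dim_Int_perp:
  assumes "finite B" "vec.subspace V"
  shows "vec.dim V \<le> vec.dim {v \<in> V. \<forall>y\<in>B. cinner_vec v y = 0} + card B"
  using assms(1)
proof induction
  case (insert b B)
  let ?W = "{v \<in> V. \<forall>y\<in>B. cinner_vec v y = 0}"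
  have "vec.subspace ?W"
    using assms(2) by (auto simp: vec.subspace_def cinner_simps)
  then have "vec.dim ?W \<le> vec.dim {v \<in> ?W. cinner_vec v b = 0} + 1"
    by (rule dim_Int_hyperplane)
  also have "{v \<in> ?W. cinner_vec v b = 0} = {v \<in> V. \<forall>y\<in>insert b B. cinner_vec v y = 0}" by auto
  finally show ?case using insert by simp
qed simp

definition perp :: "(complex^'n) set \<Rightarrow> (complex^'n) set" where
  "perp U = {v. \<forall>y\<in>U. cinner_vec v y = 0}"

lemma subspace_perp: "vec.subspace (perp U)"
  by (auto simp: perp_def vec.subspace_def cinner_simps)

lemma perp_span: "perp (vec.span B) = perp B"
proof
  show "perp (vec.span B) \<subseteq> perp B" by (auto simp: perp_def vec.span_base)
  show "perp B \<subseteq> perp (vec.span B)" using cinner_span_right by (force simp: perp_def)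
qed

lemma dim_Int_ge:
  fixes U V :: "(complex^'n) set"
  assumes "vec.subspace U" "vec.subspace V"
  shows "vec.dim U + vec.dim V \<le> vec.dim (U \<inter> V) + CARD('n)"
  using vec.dim_sums_Int[OF assms] dim_subset_UNIV_cart_gen[of "{x + y |x y. x \<in> U \<and> y \<in> V}"]
  by simp

lemma dim_perp:
  fixes U :: "(complex^'n) set"
  shows "vec.dim U + vec.dim (perp U) = CARD('n)"
proof -
  obtain B where B: "B \<subseteq> U" "vec.independent B" "U \<subseteq> vec.span B" "card B = vec.dim U"
    using vec.basis_exists by blast
  have fin: "finite B" using B(2) by (rule vec.finiteI_independent)
  have "vec.span B = vec.span U"
    using vec.span_mono[OF B(1)] vec.span_mono[OF B(3)] unfolding vec.span_span by (rule subset_antisym)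
  then have eq: "perp U = {v \<in> UNIV. \<forall>y\<in>B. cinner_vec v y = 0}"
    using perp_span[of B] perp_span[of U] by (simp add: perp_def)
  have "CARD('n) \<le> vec.dim (perp U) + vec.dim U"
    using dim_Int_perp[OF fin vec.subspace_UNIV] B(4) by (simp add: eq card_cart_basis)
  moreover have "vec.span U \<inter> perp (vec.span U) \<subseteq> {0}"
    by (auto simp: perp_def)
  then have "vec.dim (vec.span U \<inter> perp (vec.span U)) = 0"
    by simp
  then have "vec.dim (vec.span U) + vec.dim (perp (vec.span U)) \<le> CARD('n)"
    using vec.dim_sums_Int[OF vec.subspace_span[of U] subspace_perp, of "vec.span U"]
      dim_subset_UNIV_cart_gen[of "{x + y |x y. x \<in> vec.span U \<and> y \<in> perp (vec.span U)}"]
    by linarith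
  ultimately show ?thesis unfolding perp_span vec.dim_span by linarith
qed

lemma perp_perp:
  assumes "vec.subspace U"
  shows "perp (perp U) = U"
proof -
  have "U \<subseteq> perp (perp U)"
    unfolding perp_def using cinner_eq_0_commute by blast
  moreover have "vec.dim (perp (perp U)) = vec.dim U"
    using dim_perp[of U] dim_perp[of "perp U"] by linarith
  ultimately show ?thesis
    using vec.subspace_dim_equal[OF assms subspace_perp, of "perp U"] by simp
qed

lemma orth_decomp:
  fixes U :: "(complex^'n) set"
  assumes "vec.subspace U"
  obtains y z where "y \<in> U" "z \<in> perp U" "x = y + z"
proof -
  let ?S = "{y + z |y z. y \<in> U \<and> z \<in> perp U}"
  have "U \<inter> perp U \<subseteq> {0}" by (auto simp: perp_def)
  then have "vec.dim (U \<inter> perp U) = 0" by simp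
  then have "vec.dim ?S = vec.dim (UNIV :: (complex^'n) set)"
    using vec.dim_sums_Int[OF assms subspace_perp, of U] dim_perp[of U]
    unfolding vec.dim_UNIV card_cart_basis by linarith
  then have "?S = UNIV"
    by (intro vec.subspace_dim_equal[OF vec.subspace_sums[OF assms subspace_perp] vec.subspace_UNIV])
      simp_all
  then show ?thesis using that by blast
qed

section \<open>Orthogonal projections and higher rank numerical ranges\<close>

text \<open>This describes the orthogonal projection onto a subspace by its values on the subspace and
  on the complement, which is easier to use than the algebraic identities of
  \<^const>\<open>orth_projections\<close>; the next lemmas identify the two descriptions.\<close>
definition projects_onto :: "complex^'n^'n \<Rightarrow> (complex^'n) set \<Rightarrow> bool" where
  "projects_onto P U \<longleftrightarrow> (\<forall>u\<in>U. P *v u = u) \<and> (\<forall>v\<in>perp U. P *v v = 0)"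

text \<open>The component of a vector in the subspace is unique, hence depends linearly on the vector,
  hence is given by a matrix.\<close>
lemma proj_exists:
  assumes U: "vec.subspace (U :: (complex^'n) set)"
  obtains P where "projects_onto P U"
proof -
  obtain p where p: "p x \<in> U" "x - p x \<in> perp U" for x
  proof -
    have "\<exists>y. y \<in> U \<and> x - y \<in> perp U" for x
    proof -
      obtain y z where "y \<in> U" "z \<in> perp U" "x = y + z" using orth_decomp[OF U] .
      then show ?thesis by (intro exI[of _ y]) simp
    qed
    then have "\<forall>x. \<exists>y. y \<in> U \<and> x - y \<in> perp U" by blast
    from choice[OF this] show ?thesis using that by blast
  qed
  have unique: "y = p x" if "y \<in> U" "x - y \<in> perp U" for x y
  proof -
    have "y - p x \<in> U" using that p U by (simp add: vec.subspace_diff)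
    moreover have "y - p x \<in> perp U"
      using vec.subspace_diff[OF subspace_perp p(2)[of x] that(2)] by simp
    ultimately have "cinner_vec (y - p x) (y - p x) = 0" by (auto simp: perp_def)
    then show ?thesis by simp
  qed
  have "Vector_Spaces.linear (*s) (*s) p"
  proof -
    have "p (x + y) = p x + p y" for x y
      using vec.subspace_add[OF U p(1)[of x] p(1)[of y]]
        vec.subspace_add[OF subspace_perp p(2)[of x] p(2)[of y]]
      by (intro unique[symmetric]) (simp_all add: algebra_simps)
    moreover have "p (c *s x) = c *s p x" for c x
      using vec.subspace_scale[OF U p(1)[of x]]
        vec.subspace_scale[OF subspace_perp p(2)[of x], of c]
      by (intro unique[symmetric]) (simp_all add: algebra_simps)
    ultimately show ?thesis unfolding Vector_Spaces.linear_iff by (simp add: vec.vector_space_axioms)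
  qed
  then have "matrix p *v x = p x" for x by (rule matrix_works)
  moreover have "p u = u" if "u \<in> U" for u
    using unique[OF that, of u] vec.subspace_0[OF subspace_perp, of U] by simp
  moreover have "p u = 0" if "u \<in> perp U" for u
    using unique[OF vec.subspace_0[OF U], of u] that by simp
  ultimately have "projects_onto (matrix p) U" by (simp add: projects_onto_def)
  then show ?thesis by (rule that)
qed

text \<open>The rank of a matrix is the dimension of its row space, while its kernel is the orthogonal
  complement of the conjugated rows. Entrywise conjugation is only conjugate-linear, so that it
  preserves dimensions needs its own argument.\<close>
definition conj_vec :: "complex^'n \<Rightarrow> complex^'n" where "conj_vec x = (\<chi> i. cnj (x $ i))"

lemma dim_conj_vec_image: "vec.dim (conj_vec ` S) = vec.dim (S :: (complex^'n) set)"
proof -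
  have le: "vec.dim (conj_vec ` S) \<le> vec.dim S" for S :: "(complex^'n) set"
  proof -
    obtain B where B: "B \<subseteq> S" "vec.independent B" "S \<subseteq> vec.span B" "card B = vec.dim S"
      using vec.basis_exists by blast
    have fin: "finite B" using B(2) by (rule vec.finiteI_independent)
    have "conj_vec x \<in> vec.span (conj_vec ` B)" if "x \<in> vec.span B" for x
      using that
    proof (induction rule: vec.span_induct_alt)
      case base
      have "conj_vec 0 = (0 :: complex^'n)" by (simp add: conj_vec_def vec_eq_iff)
      then show ?case by (simp add: vec.span_zero)
    next
      case (step c x y)
      have "conj_vec (c *s x + y) = cnj c *s conj_vec x + conj_vec y" by (simp add: conj_vec_def vec_eq_iff)
      then show ?case using step by (simp add: vec.span_add vec.span_scale vec.span_base)
    qed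
    then have "conj_vec ` S \<subseteq> vec.span (conj_vec ` B)" using B(3) by blast
    then have "vec.dim (conj_vec ` S) \<le> card (conj_vec ` B)" using fin by (simp add: vec.dim_le_card)
    also have "\<dots> \<le> card B" using fin by (rule card_image_le)
    finally show ?thesis using B by simp
  qed
  have "conj_vec ` conj_vec ` S = S" by (simp add: image_image conj_vec_def)
  then show ?thesis using le[of S] le[of "conj_vec ` S"] by simp
qed

lemma dim_kernel:
  fixes F :: "complex^'n^'n"
  shows "vec.dim {x. F *v x = 0} + rank F = CARD('n)"
proof -
  have "{x. F *v x = 0} = perp (conj_vec ` rows F)"
  proof -
    have "(F *v x) $ i = cinner_vec x (conj_vec (row i F))" for x i
      by (simp add: matrix_vector_mult_def cinner_vec_def conj_vec_def row_def mult.commute)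
    then have "F *v x = 0 \<longleftrightarrow> (\<forall>i. cinner_vec x (conj_vec (row i F)) = 0)" for x
      by (simp add: vec_eq_iff)
    then show ?thesis by (auto simp: perp_def rows_def)
  qed
  then show ?thesis
    using dim_perp[of "conj_vec ` rows F"] by (simp add: dim_conj_vec_image row_rank_def_gen)
qed

lemma subspace_kernel: "vec.subspace {x. (F :: complex^'n^'m) *v x = 0}"
  by (auto simp: vec.subspace_def matrix_vector_right_distrib vector_scalar_commute)

lemma projects_onto_imp_orth_projection:
  fixes P :: "complex^'n^'n"
  assumes U: "vec.subspace U" and P: "projects_onto P U"
  shows "P \<in> orth_projections (vec.dim U)"
proof -
  have dec: "\<exists>y z. y \<in> U \<and> z \<in> perp U \<and> x = y + z \<and> P *v x = y" for x
  proof -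
    obtain y z where "y \<in> U" "z \<in> perp U" "x = y + z" using orth_decomp[OF U] .
    then show ?thesis using P by (auto simp: projects_onto_def matrix_vector_right_distrib)
  qed
  have "P *v (P *v x) = P *v x" for x
  proof -
    have "P *v x \<in> U" using dec[of x] by auto
    then show ?thesis using P by (simp add: projects_onto_def)
  qed
  then have "P ** P = P"
    by (simp add: matrix_eq flip: matrix_vector_mul_assoc)
  moreover have "conj_transpose P *v x = P *v x" for x
  proof (rule cinner_left_ext)
    fix y
    obtain x1 x2 where x: "x1 \<in> U" "x2 \<in> perp U" "x = x1 + x2" "P *v x = x1" using dec by blast
    obtain y1 y2 where y: "y1 \<in> U" "y2 \<in> perp U" "y = y1 + y2" "P *v y = y1" using dec by blast
    have "cinner_vec x2 y1 = 0" "cinner_vec y2 x1 = 0"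
      using x y by (auto simp: perp_def)
    then have "cinner_vec x2 y1 = 0" "cinner_vec x1 y2 = 0"
      using cinner_eq_0_commute by blast+
    moreover have "cinner_vec (conj_transpose P *v x) y = cinner_vec x (P *v y)"
      by (simp add: cinner_adjoint)
    ultimately show "cinner_vec (conj_transpose P *v x) y = cinner_vec (P *v x) y"
      using x y by (simp add: cinner_simps)
  qed
  then have "conj_transpose P = P" by (simp add: matrix_eq)
  moreover have "{x. P *v x = 0} = perp U"
  proof (intro equalityI subsetI)
    fix x assume "x \<in> {x. P *v x = 0}"
    moreover obtain y z where "z \<in> perp U" "x = y + z" "P *v x = y" using dec by blast
    ultimately show "x \<in> perp U" by simp
  next
    fix x assume "x \<in> perp U"
    then show "x \<in> {x. P *v x = 0}" using P by (auto simp: projects_onto_def)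
  qed
  then have "rank P = vec.dim U"
    using dim_kernel[of P] dim_perp[of U] by simp
  ultimately show ?thesis by (simp add: orth_projections_def)
qed

text \<open>A self-adjoint idempotent projects onto the orthogonal complement of its kernel.\<close>
lemma orth_projection_projects_onto:
  fixes P :: "complex^'n^'n"
  assumes "P \<in> orth_projections m"
  obtains U where "vec.subspace U" "vec.dim U = m" "projects_onto P U"
proof
  let ?K = "{x. P *v x = 0}"
  show "vec.subspace (perp ?K)" by (rule subspace_perp)
  have P: "P ** P = P" "conj_transpose P = P" "rank P = m"
    using assms by (auto simp: orth_projections_def)
  show "vec.dim (perp ?K) = m" using dim_kernel[of P] dim_perp[of ?K] P by simp
  have PP: "P *v (P *v x) = P *v x" for x by (simp add: matrix_vector_mul_assoc P)
  have sym: "cinner_vec (P *v x) y = cinner_vec x (P *v y)" for x y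
    using cinner_adjoint[of P x y] P by simp
  have "P *v u = u" if "u \<in> perp ?K" for u
  proof -
    have k: "u - P *v u \<in> ?K" by (simp add: matrix_vector_mult_diff_distrib PP)
    then have "cinner_vec u (u - P *v u) = 0" using that by (auto simp: perp_def)
    moreover have "cinner_vec (P *v u) (u - P *v u) = 0" using k sym by simp
    ultimately have "cinner_vec (u - P *v u) (u - P *v u) = 0"
      by (subst cinner_diff_left) simp
    then show ?thesis by simp
  qed
  moreover have "perp (perp ?K) = ?K" by (rule perp_perp[OF subspace_kernel])
  ultimately show "projects_onto P (perp ?K)" by (simp add: projects_onto_def)
qed

lemma projects_onto_range:
  assumes "vec.subspace U" "projects_onto P U"
  shows "P *v x \<in> U"
proof -
  obtain y z where "y \<in> U" "z \<in> perp U" "x = y + z" using orth_decomp[OF assms(1)] .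
  then show ?thesis using assms(2) by (simp add: projects_onto_def matrix_vector_right_distrib)
qed

lemma subspace_of_dim:
  assumes "vec.subspace U" "m \<le> vec.dim U"
  obtains V where "vec.subspace V" "V \<subseteq> U" "vec.dim V = m"
proof -
  obtain B where B: "B \<subseteq> U" "vec.independent B" "U \<subseteq> vec.span B" "card B = vec.dim U"
    using vec.basis_exists by blast
  obtain C where C: "C \<subseteq> B" "card C = m" using obtain_subset_with_card_n[of m B] assms(2) B(4) by auto
  have "vec.independent C" using B C vec.independent_mono by blast
  then have "vec.dim (vec.span C) = m" using C by (simp add: vec.dim_eq_card_independent)
  moreover have "vec.span C \<subseteq> U" using B C assms by (meson order_trans vec.span_minimal)
  ultimately show ?thesis using that vec.subspace_span by blast
qed

definition scalar_on :: "complex^'n^'n \<Rightarrow> complex \<Rightarrow> (complex^'n) set \<Rightarrow> bool" where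
  "scalar_on A c V \<longleftrightarrow> (\<forall>x\<in>V. \<forall>y\<in>V. cinner_vec (A *v x) y = c * cinner_vec x y)"

text \<open>Compressing by a projection onto \<open>V\<close> sees exactly the form of the matrix on
  \<open>V\<close>. In this shape the higher rank numerical range is a statement about subspaces
  only.\<close>
lemma higher_rank_range_iff:
  "c \<in> higher_rank_range m A \<longleftrightarrow> (\<exists>V. vec.subspace V \<and> vec.dim V = m \<and> scalar_on A c V)"
proof
  assume "c \<in> higher_rank_range m A"
  then obtain P where P: "P \<in> orth_projections m" "P ** A ** P = scale_matrix c P"
    by (auto simp: higher_rank_range_def)
  obtain V where V: "vec.subspace V" "vec.dim V = m" "projects_onto P V"
    using orth_projection_projects_onto[OF P(1)] .
  have "cinner_vec (A *v x) y = c * cinner_vec x y" if "x \<in> V" "y \<in> V" for x y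
  proof -
    have Pxy: "P *v x = x" "P *v y = y" using V that by (auto simp: projects_onto_def)
    have "cinner_vec (A *v x) y = cinner_vec (A *v (P *v x)) (conj_transpose P *v y)"
      using P Pxy by (simp add: orth_projections_def)
    also have "\<dots> = cinner_vec ((P ** A ** P) *v x) y"
      by (simp add: cinner_adjoint flip: matrix_vector_mul_assoc)
    finally show ?thesis using P Pxy by (simp add: scale_matrix_vec cinner_simps)
  qed
  then show "\<exists>V. vec.subspace V \<and> vec.dim V = m \<and> scalar_on A c V"
    using V by (auto simp: scalar_on_def)
next
  assume "\<exists>V. vec.subspace V \<and> vec.dim V = m \<and> scalar_on A c V"
  then obtain V where V: "vec.subspace V" "vec.dim V = m" "scalar_on A c V" by blast
  obtain P where P: "projects_onto P V" using proj_exists[OF V(1)] .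
  have PV: "P *v x \<in> V" for x using projects_onto_range[OF V(1) P] .
  have Pm: "P \<in> orth_projections m" using projects_onto_imp_orth_projection[OF V(1) P] V by simp
  then have Ps: "conj_transpose P = P" and PP: "P ** P = P" by (auto simp: orth_projections_def)
  have "(P ** A ** P) *v x = scale_matrix c P *v x" for x
  proof (rule cinner_left_ext)
    fix y
    have "cinner_vec ((P ** A ** P) *v x) y = cinner_vec (A *v (P *v x)) (P *v y)"
      using cinner_adjoint[of P] Ps by (simp flip: matrix_vector_mul_assoc)
    also have "\<dots> = c * cinner_vec (P *v x) (P *v y)"
      using V PV by (simp add: scalar_on_def)
    also have "\<dots> = c * cinner_vec (P *v x) y"
      using cinner_adjoint[of P "P *v x" y] Ps PP by (simp add: matrix_vector_mul_assoc)
    finally show "cinner_vec ((P ** A ** P) *v x) y = cinner_vec (scale_matrix c P *v x) y"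
      by (simp add: scale_matrix_vec cinner_simps)
  qed
  then have "P ** A ** P = scale_matrix c P" by (simp add: matrix_eq)
  then show "c \<in> higher_rank_range m A" using Pm by (auto simp: higher_rank_range_def)
qed

lemma scalar_on_subset: "scalar_on A c V \<Longrightarrow> W \<subseteq> V \<Longrightarrow> scalar_on A c W"
  by (auto simp: scalar_on_def)

text \<open>On the kernel of \<open>F\<close>, which meets any \<open>k\<close>-dimensional subspace in
  dimension at least \<open>k - r\<close>, the matrices \<open>A\<close> and \<open>A + F\<close> have
  the same form.\<close>
lemma higher_rank_range_perturb:
  fixes A F :: "complex^'n^'n"
  assumes "c \<in> higher_rank_range k A" "rank F \<le> r" 
  shows "c \<in> higher_rank_range (k - r) (A + F)"
proof -
  obtain V where V: "vec.subspace V" "vec.dim V = k" "scalar_on A c V"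
    using assms higher_rank_range_iff by blast
  let ?K = "{x. F *v x = 0}"
  have "k - r \<le> vec.dim (V \<inter> ?K)"
    using dim_Int_ge[OF V(1) subspace_kernel, of F] dim_kernel[of F] assms V by simp
  then obtain W where W: "vec.subspace W" "W \<subseteq> V \<inter> ?K" "vec.dim W = k - r"
    using subspace_of_dim vec.subspace_inter[OF V(1) subspace_kernel] by metis
  have "scalar_on (A + F) c W"
    using V W unfolding scalar_on_def
    by (auto simp: matrix_vector_mult_add_rdistrib subset_iff)
  then show ?thesis using W higher_rank_range_iff by blast
qed

section \<open>Eigenvectors of a form relative to its adjoint\<close>

text \<open>Indexing by numbers instead of taking the set of values covers families with repetitions,
  such as the orbit of a vector under a matrix.\<close>
lemma vectors_dependent:
  fixes v :: "nat \<Rightarrow> complex^'n"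
  assumes "CARD('n) < N"
  obtains c where "\<exists>i<N. c i \<noteq> 0" "(\<Sum>i<N. c i *s v i) = 0"
proof (cases "inj_on v {..<N}")
  case True
  let ?S = "v ` {..<N}"
  have "vec.dim ?S < card ?S"
    using dim_subset_UNIV_cart_gen[of ?S] assms True by (simp add: card_image)
  then have "vec.dependent ?S"
    using vec.dim_eq_card_independent[of ?S] by auto
  then obtain u where u: "\<exists>x\<in>?S. u x \<noteq> 0" "(\<Sum>x\<in>?S. u x *s x) = 0"
    using vec.dependent_finite[of ?S] by auto
  have "(\<Sum>i<N. u (v i) *s v i) = 0"
    using u(2) True by (simp add: sum.reindex)
  then show ?thesis using u(1) that[of "\<lambda>i. u (v i)"] by auto
next
  case False
  then obtain i j where ij: "i < N" "j < N" "i \<noteq> j" "v i = v j"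
    by (auto simp: inj_on_def)
  let ?c = "\<lambda>l. (if l = i then 1 else 0) - (if l = j then 1 else 0) :: complex"
  have "(\<Sum>l<N. ?c l *s v l) = (\<Sum>l<N. (if l = i then v i else 0) - (if l = j then v j else 0))"
    by (rule sum.cong) auto
  also have "\<dots> = 0" using ij by (simp add: sum_subtractf)
  finally have "(\<Sum>l<N. ?c l *s v l) = 0" .
  moreover have "\<exists>l<N. ?c l \<noteq> 0" using ij by (intro exI[of _ i]) simp
  ultimately show ?thesis using that[of ?c] by blast
qed

text \<open>The orbit of a vector of \<open>U\<close> under \<open>C\<close> is linearly dependent, so
  some nonzero polynomial in \<open>C\<close> annihilates the vector. Over the complex numbers one can
  split off linear factors one at a time, and the last step at which the vector is not yet annihilated
  exhibits an eigenvector. All these vectors stay in \<open>U\<close>.\<close>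
lemma eigenvector_exists:
  fixes C :: "complex^'n^'n"
  assumes U: "vec.subspace U" and inv: "\<And>u. u \<in> U \<Longrightarrow> C *v u \<in> U"
    and x: "x \<in> U" "x \<noteq> 0"
  obtains e \<mu> where "e \<in> U" "e \<noteq> 0" "C *v e = \<mu> *s e"
proof -
  define N where "N = CARD('n) + 1"
  define v where "v i = ((*v) C ^^ i) x" for i
  have vS: "v (Suc i) = C *v v i" for i by (simp add: v_def)
  have vU: "v i \<in> U" for i by (induction i) (use x inv in \<open>auto simp: v_def\<close>)
  define E where "E p = (\<Sum>i<N. coeff p i *s v i)" for p
  have EU: "E p \<in> U" for p
    unfolding E_def using U vU by (intro vec.subspace_sum vec.subspace_scale)
  have Emult: "E ([:-\<mu>, 1:] * q) = C *v E q - \<mu> *s E q" if "Suc (degree q) < N" for \<mu> q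
  proof -
    obtain N' where N': "N = Suc N'" "degree q < N'" using \<open>Suc (degree q) < N\<close> by (cases N) auto
    have "E ([:-\<mu>, 1:] * q) = (\<Sum>i<N. coeff (pCons 0 q) i *s v i) - \<mu> *s E q"
      unfolding E_def by (simp add: vec.scale_sum_right vec.scale_left_diff_distrib sum_subtractf
          algebra_simps)
    also have "(\<Sum>i<N. coeff (pCons 0 q) i *s v i) = (\<Sum>i<N'. coeff q i *s v (Suc i))"
      unfolding N' sum.lessThan_Suc_shift by simp
    also have "\<dots> = C *v E q"
      unfolding E_def N' by (simp add: matrix_vector_right_distrib vS coeff_eq_0 N'
          vec.linear_sum[OF matrix_vector_mul_linear_gen] vector_scalar_commute)
    finally show ?thesis .
  qed
  have main: "\<exists>e \<mu>. e \<in> U \<and> e \<noteq> 0 \<and> C *v e = \<mu> *s e"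
    if "p \<noteq> 0" "degree p < N" "E p = 0" for p
    using that
  proof (induction "degree p" arbitrary: p)
    case 0
    then obtain a where a: "p = [:a:]" "a \<noteq> 0" by (metis degree_eq_zeroE pCons_eq_0_iff)
    have "E p = (\<Sum>i<N. if i = 0 then a *s x else 0)"
      unfolding E_def a by (rule sum.cong) (auto simp: v_def coeff_pCons split: nat.splits)
    also have "\<dots> = a *s x" by (simp add: N_def)
    finally show ?case using 0 a x by (simp add: vec.scale_eq_0_iff)
  next
    case (Suc d)
    then obtain \<mu> where "poly p \<mu> = 0"
      using fundamental_theorem_of_algebra_alt[of p] constant_degree[of p]
      by (metis fundamental_theorem_of_algebra nat.distinct(1))
    then obtain q where q: "p = [:-\<mu>, 1:] * q" using poly_eq_0_iff_dvd by (metis dvdE)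
    then have q0: "q \<noteq> 0" using Suc by auto
    then have dq: "degree p = Suc (degree q)" using degree_mult_eq[of "[:-\<mu>, 1:]" q] q by simp
    then have "C *v E q - \<mu> *s E q = 0" using Emult[of q \<mu>] Suc q by simp
    then show ?case
      using Suc.hyps(1)[of q] Suc.hyps(2) Suc.prems dq q0 EU[of q]
      by (cases "E q = 0") auto
  qed
  obtain c where c: "\<exists>i<N. c i \<noteq> 0" "(\<Sum>i<N. c i *s v i) = 0"
    using vectors_dependent[of N v] by (auto simp: N_def)
  define p where "p = (\<Sum>i<N. monom (c i) i)"
  have cp: "coeff p i = (if i < N then c i else 0)" for i
    by (simp add: p_def coeff_sum)
  have "p \<noteq> 0" using c(1) cp by (metis coeff_0)
  moreover have "degree p < N"
    by (metis cp coeff_0 \<open>p \<noteq> 0\<close> leading_coeff_0_iff)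
  moreover have "E p = 0" using c(2) by (simp add: E_def cp)
  ultimately show ?thesis using main that by blast
qed

lemma cinner_proj:
  assumes "vec.subspace U" "projects_onto P U" "u \<in> U"
  shows "cinner_vec (P *v z) u = cinner_vec z u"
proof -
  obtain a b where ab: "a \<in> U" "b \<in> perp U" "z = a + b" using orth_decomp[OF assms(1)] .
  then have "cinner_vec b u = 0" using assms by (auto simp: perp_def)
  then show ?thesis
    using ab assms by (simp add: projects_onto_def matrix_vector_right_distrib cinner_simps)
qed

text \<open>If the form of \<open>N\<close> is degenerate on \<open>U\<close>, any nonzero
  \<open>x\<close> with \<open>\<langle>Nx, \<cdot>\<rangle> = 0\<close> on \<open>U\<close> is an
  eigenvector with \<open>\<alpha> = 0\<close>. Otherwise the compression of \<open>N\<close> to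
  \<open>U\<close> is invertible, and its inverse times the compression of \<open>M\<close> has an
  eigenvector in \<open>U\<close>. The homogeneous coefficients \<open>\<alpha>\<close>,
  \<open>\<beta>\<close> cover both cases.\<close>
lemma pencil_eigenvector:
  fixes M N :: "complex^'n^'n"
  assumes U: "vec.subspace U" and ne: "x0 \<in> U" "x0 \<noteq> 0"
  obtains x \<alpha> \<beta> where "x \<in> U" "x \<noteq> 0" "\<alpha> \<noteq> 0 \<or> \<beta> \<noteq> 0"
    "\<And>u. u \<in> U \<Longrightarrow> \<alpha> * cinner_vec (M *v x) u = \<beta> * cinner_vec (N *v x) u"
proof (cases "\<exists>x\<in>U. x \<noteq> 0 \<and> (\<forall>u\<in>U. cinner_vec (N *v x) u = 0)")
  case True
  then show ?thesis using that[of _ 0 1] by auto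
next
  case False
  obtain P where P: "projects_onto P U" using proj_exists[OF U] .
  have PU: "P *v x \<in> U" for x by (rule projects_onto_range[OF U P])
  have Pid: "P *v x = x" if "x \<in> U" for x using P that by (simp add: projects_onto_def)
  have Pperp: "x - P *v x \<in> perp U" for x
    using cinner_proj[OF U P] by (auto simp: perp_def cinner_simps)
  have disj: "z = 0" if "z \<in> U" "z \<in> perp U" for z
    using that by (force simp: perp_def)
  \<comment> \<open>The compression of \<open>N\<close> to \<open>U\<close>, continued by the identity on the complement of \<open>U\<close> so
    that it can be inverted as a square matrix.\<close>
  define K where "K = P ** N ** P + (mat 1 - P)"
  have K: "K *v v = P *v (N *v (P *v v)) + (v - P *v v)" for v
    by (simp add: K_def matrix_vector_mult_add_rdistrib matrix_vector_mult_diff_rdistrib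
        flip: matrix_vector_mul_assoc)
  have Kin: "P *v v = v" if "K *v v \<in> U" for v
  proof -
    have "K *v v - P *v (N *v (P *v v)) \<in> U" using that PU U by (simp add: vec.subspace_diff)
    then have "v - P *v v \<in> U" by (simp add: K)
    then have "v - P *v v = 0" by (rule disj[OF _ Pperp])
    then show ?thesis by simp
  qed
  have "v = 0" if "K *v v = 0" for v
  proof (rule ccontr)
    assume "v \<noteq> 0"
    have v: "P *v v = v" using Kin[of v] that U by (simp add: vec.subspace_0)
    then have "v \<in> U" using PU[of v] by simp
    moreover have "P *v (N *v v) = 0" using that v by (simp add: K)
    then have "\<forall>u\<in>U. cinner_vec (N *v v) u = 0" using cinner_proj[OF U P, of _ "N *v v"] by simp
    ultimately show False using False \<open>v \<noteq> 0\<close> by blast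
  qed
  then obtain L where "L ** K = mat 1" using matrix_left_invertible_ker[of K] by auto
  then have KL: "K ** L = mat 1" using matrix_left_right_inverse by blast
  have KLv: "K *v (L *v z) = z" for z by (simp add: matrix_vector_mul_assoc KL)
  have "(L ** P ** M) *v u \<in> U" for u
  proof -
    have eq: "(L ** P ** M) *v u = L *v (P *v (M *v u))" by (simp flip: matrix_vector_mul_assoc)
    have "P *v (L *v (P *v (M *v u))) = L *v (P *v (M *v u))"
      by (rule Kin) (simp add: KLv PU)
    then show ?thesis using PU eq by metis
  qed
  then obtain e \<mu> where e: "e \<in> U" "e \<noteq> 0" "(L ** P ** M) *v e = \<mu> *s e"
    using eigenvector_exists[OF U _ ne] by metis
  have "P *v (M *v e) = K *v ((L ** P ** M) *v e)"
    using KLv by (simp flip: matrix_vector_mul_assoc)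
  also have "\<dots> = \<mu> *s (P *v (N *v e))"
    using e Pid[OF e(1)] by (simp add: K vector_scalar_commute)
  finally have "cinner_vec (M *v e) u = \<mu> * cinner_vec (N *v e) u" if "u \<in> U" for u
    using cinner_proj[OF U P that] by (metis cinner_scale_left)
  then show ?thesis using that[of e 1 \<mu>] e by auto
qed

text \<open>Proportionality of the functionals \<open>\<langle>Ax, \<cdot>\<rangle>\<close> and
  \<open>\<langle>A\<^sup>* x, \<cdot>\<rangle>\<close> on \<open>U\<close> makes their common kernel
  all of \<open>U\<close> or a hyperplane of \<open>U\<close>, so a vector of this kind can be split off
  at the cost of at most two dimensions.\<close>
definition isotropic_eigenvector :: "complex^'n^'n \<Rightarrow> (complex^'n) set \<Rightarrow> complex^'n \<Rightarrow> bool" where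
  "isotropic_eigenvector A U x \<longleftrightarrow> x \<in> U \<and> x \<noteq> 0 \<and> cinner_vec (A *v x) x = 0 \<and>
     (\<exists>\<alpha> \<beta>. (\<alpha> \<noteq> 0 \<or> \<beta> \<noteq> 0) \<and>
       (\<forall>u\<in>U. \<alpha> * cinner_vec (A *v x) u = \<beta> * cinner_vec (conj_transpose A *v x) u))"

text \<open>Any eigenvector \<open>x\<close> of the pencil of \<open>A\<close> and its adjoint on
  \<open>U\<close> satisfies \<open>\<langle>Ax, x\<rangle> \<noteq> 0\<close> here. Therefore the left
  and the right orthogonal of \<open>x\<close> coincide and complement the line of \<open>x\<close>, and
  the hypothesis is inherited by this complement.\<close>
lemma diagonalising_basis:
  fixes A :: "complex^'n^'n"
  assumes "vec.subspace U" "\<And>x. \<not> isotropic_eigenvector A U x"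
  shows "\<exists>B. vec.independent B \<and> vec.span B = U \<and>
    (\<forall>x\<in>B. \<forall>y\<in>B. x \<noteq> y \<longrightarrow> cinner_vec (A *v x) y = 0)"
  using assms
proof (induction "vec.dim U" arbitrary: U rule: less_induct)
  case less
  note U = \<open>vec.subspace U\<close>
  show ?case
  proof (cases "U = {0}")
    case True
    then show ?thesis by (intro exI[of _ "{}"]) (auto simp: vec.independent_empty)
  next
    case False
    then obtain x0 where "x0 \<in> U" "x0 \<noteq> 0" using vec.subspace_0[OF U] by blast
    then obtain x \<alpha> \<beta> where x: "x \<in> U" "x \<noteq> 0" "\<alpha> \<noteq> 0 \<or> \<beta> \<noteq> 0"
      "\<And>u. u \<in> U \<Longrightarrow> \<alpha> * cinner_vec (A *v x) u = \<beta> * cinner_vec (conj_transpose A *v x) u"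
      using pencil_eigenvector[OF U, of x0 A "conj_transpose A"] by metis
    define c where "c = cinner_vec (A *v x) x"
    have c: "c \<noteq> 0" using less.prems(2)[of x] x by (auto simp: isotropic_eigenvector_def c_def)
    have "\<alpha> * c = \<beta> * cnj c" using x(4)[OF x(1)] by (simp add: c_def cinner_adjoint_left)
    then have "\<beta> \<noteq> 0" using c x(3) by auto
    define U' where "U' = {u \<in> U. cinner_vec (A *v x) u = 0}"
    have U': "vec.subspace U'"
      using U by (auto simp: U'_def vec.subspace_def cinner_simps)
    have right: "cinner_vec (A *v u) x = 0" if "u \<in> U'" for u
      using x(4)[of u] that \<open>\<beta> \<noteq> 0\<close> by (auto simp: U'_def cinner_adjoint_left)
    have dec: "\<exists>d u'. u' \<in> U' \<and> u = d *s x + u'" if "u \<in> U" for u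
    proof -
      let ?d = "cnj (cinner_vec (A *v x) u / c)"
      have "u - ?d *s x \<in> U'"
        using that x(1) U c
        by (simp add: U'_def vec.subspace_diff vec.subspace_scale cinner_simps flip: c_def)
      then show ?thesis by (intro exI[of _ ?d] exI[of _ "u - ?d *s x"]) simp
    qed
    have sub: "U' \<subseteq> U" by (auto simp: U'_def)
    have xU': "x \<notin> U'" using c by (simp add: U'_def c_def)
    have "vec.dim U' < vec.dim U"
    proof (rule vec.dim_psubset)
      have "vec.span U = U" "vec.span U' = U'" using U U' vec.span_eq_iff by blast+
      then show "vec.span U' \<subset> vec.span U" using sub xU' x(1) by blast
    qed
    moreover have "\<not> isotropic_eigenvector A U' y" for y
    proof
      assume y: "isotropic_eigenvector A U' y"
      then obtain \<alpha>' \<beta>' where ab: "\<alpha>' \<noteq> 0 \<or> \<beta>' \<noteq> 0"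
        "\<forall>u\<in>U'. \<alpha>' * cinner_vec (A *v y) u = \<beta>' * cinner_vec (conj_transpose A *v y) u"
        by (auto simp: isotropic_eigenvector_def)
      have yU': "y \<in> U'" using y by (simp add: isotropic_eigenvector_def)
      have "cinner_vec (A *v y) x = 0" "cinner_vec (conj_transpose A *v y) x = 0"
        using right[OF yU'] yU' by (auto simp: cinner_adjoint_left U'_def)
      then have "\<forall>u\<in>U. \<alpha>' * cinner_vec (A *v y) u = \<beta>' * cinner_vec (conj_transpose A *v y) u"
        using dec ab by (force simp: cinner_simps)
      then have "isotropic_eigenvector A U y"
        using y ab(1) sub unfolding isotropic_eigenvector_def by blast
      then show False using less.prems(2) by blast
    qed
    ultimately obtain B where B: "vec.independent B" "vec.span B = U'"
      "\<forall>x\<in>B. \<forall>y\<in>B. x \<noteq> y \<longrightarrow> cinner_vec (A *v x) y = 0"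
      using less.hyps[OF _ U'] by blast
    have BU': "B \<subseteq> U'" using B(2) vec.span_superset by blast
    have "vec.independent (insert x B)"
      using B(1,2) xU' by (simp add: vec.independent_insertI)
    moreover have "vec.span (insert x B) = U"
    proof
      show "vec.span (insert x B) \<subseteq> U"
        using BU' sub x(1) U by (intro vec.span_minimal) auto
      show "U \<subseteq> vec.span (insert x B)"
      proof
        fix u assume "u \<in> U"
        then obtain d u' where "u' \<in> U'" "u = d *s x + u'" using dec by blast
        then show "u \<in> vec.span (insert x B)"
          using B(2) by (auto simp: vec.span_insert intro!: exI[of _ d])
      qed
    qed
    moreover have "\<forall>y\<in>insert x B. \<forall>z\<in>insert x B. y \<noteq> z \<longrightarrow> cinner_vec (A *v y) z = 0"
      using B(3) BU' right by (auto simp: U'_def)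
    ultimately show ?thesis by blast
  qed
qed

section \<open>Splitting off an isotropic eigenvector\<close>

definition nonneg_on :: "complex \<Rightarrow> complex^'n^'n \<Rightarrow> (complex^'n) set \<Rightarrow> bool" where
  "nonneg_on w A V \<longleftrightarrow> (\<forall>v\<in>V. 0 \<le> Re (w * cinner_vec (A *v v) v))"

text \<open>Finitely many directions \<open>w\<close> are exempted because splitting off an isotropic
  eigenvector \<open>x\<close> can destroy the condition at those \<open>w\<close> for which
  \<open>x\<close> is in the radical of the Hermitian part of \<open>w A\<close>.\<close>
definition generically_nonneg :: "complex^'n^'n \<Rightarrow> (complex^'n) set \<Rightarrow> nat \<Rightarrow> bool" where
  "generically_nonneg A U k \<longleftrightarrow> (\<exists>F. finite F \<and> (\<forall>w. norm w = 1 \<longrightarrow> w \<notin> F \<longrightarrow>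
     (\<exists>V. vec.subspace V \<and> V \<subseteq> U \<and> k \<le> vec.dim V \<and> nonneg_on w A V)))"

lemma form_add_scaled:
  "cinner_vec (A *v (v + s *s x)) (v + s *s x) =
     cinner_vec (A *v v) v + s * cinner_vec (A *v x) v + cnj s * cinner_vec (A *v v) x
     + (s * cnj s) * cinner_vec (A *v x) x"
  by (simp add: matrix_vector_right_distrib vector_scalar_commute cinner_simps algebra_simps)

text \<open>A null vector of a positive semidefinite Hermitian form lies in its radical. If the
  displayed value were nonzero, then moving from \<open>v\<close> in the direction of \<open>x\<close>
  would change the form linearly and make it negative.\<close>
lemma nonneg_on_isotropic_radical:
  assumes V: "vec.subspace V" "nonneg_on w A V" and x: "x \<in> V" "cinner_vec (A *v x) x = 0"
    and v: "v \<in> V"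
  shows "w * cinner_vec (A *v x) v + cnj w * cinner_vec (conj_transpose A *v x) v = 0"
proof (rule ccontr)
  let ?h = "w * cinner_vec (A *v x) v + cnj w * cinner_vec (conj_transpose A *v x) v"
  assume "?h \<noteq> 0"
  define Q where "Q = Re (w * cinner_vec (A *v v) v)"
  \<comment> \<open>Chosen so that the form drops from \<open>Q\<close> to \<open>-1\<close>.\<close>
  define s where "s = - of_real (Q + 1) / ?h"
  have "v + s *s x \<in> V" using V(1) x(1) v by (simp add: vec.subspace_add vec.subspace_scale)
  then have "0 \<le> Re (w * cinner_vec (A *v (v + s *s x)) (v + s *s x))"
    using V(2) by (simp add: nonneg_on_def)
  also have "w * cinner_vec (A *v (v + s *s x)) (v + s *s x) = w * cinner_vec (A *v v) v
      + (s * (w * cinner_vec (A *v x) v) + w * (cnj s * cinner_vec (A *v v) x))"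
    unfolding form_add_scaled x(2) by (simp add: algebra_simps)
  also have "Re \<dots> = Q + (Re (s * (w * cinner_vec (A *v x) v)) + Re (w * (cnj s * cinner_vec (A *v v) x)))"
    unfolding Q_def by (simp only: plus_complex.sel)
  also have "Re (w * (cnj s * cinner_vec (A *v v) x)) = Re (cnj (w * (cnj s * cinner_vec (A *v v) x)))"
    by (simp only: cnj.sel)
  also have "cnj (w * (cnj s * cinner_vec (A *v v) x)) = s * (cnj w * cinner_vec (conj_transpose A *v x) v)"
    by (simp add: cinner_adjoint_left)
  also have "Q + (Re (s * (w * cinner_vec (A *v x) v))
      + Re (s * (cnj w * cinner_vec (conj_transpose A *v x) v))) = Q + Re (s * ?h)"
    by (simp add: algebra_simps)
  also have "s * ?h = - of_real (Q + 1)" using \<open>?h \<noteq> 0\<close> by (simp add: s_def)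
  finally show False by simp
qed

text \<open>The subspace \<open>U'\<close> represents the quotient of the two-sided orthogonal
  \<open>X\<close> of \<open>x\<close> in \<open>U\<close> by the line of \<open>x\<close>. Let
  \<open>V\<close> be a \<open>k\<close>-dimensional subspace on which the Hermitian part of \<open>w
  A\<close> is nonnegative. Since \<open>X\<close> has codimension at most one, \<open>V\<close> loses
  at most one dimension on intersecting with \<open>X\<close>, and passing to the quotient loses a
  further one only if \<open>x\<close> is in \<open>V\<close>. In that case nonnegativity forces
  \<open>x\<close> to be orthogonal to \<open>V\<close> for the Hermitian part of \<open>w A\<close>,
  and except for the at most two \<open>w\<close> for which \<open>x\<close> is in the radical on all of
  \<open>U\<close>, this means that \<open>V\<close> is contained in \<open>X\<close>. So never more
  than one dimension is lost.\<close>
lemma isotropic_eigenvector_reduction: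
  fixes A :: "complex^'n^'n"
  assumes U: "vec.subspace U" and iso: "isotropic_eigenvector A U x" and pos: "generically_nonneg A U k"
  obtains U' where "vec.subspace U'" "U' \<subseteq> U" "x \<notin> U'"
    "\<And>u. u \<in> U' \<Longrightarrow> cinner_vec (A *v x) u = 0 \<and> cinner_vec (A *v u) x = 0"
    "generically_nonneg A U' (k - 1)"
proof -
  obtain \<alpha> \<beta> where x: "x \<in> U" "x \<noteq> 0" "cinner_vec (A *v x) x = 0" and ab: "\<alpha> \<noteq> 0 \<or> \<beta> \<noteq> 0"
    and lin: "\<And>u. u \<in> U \<Longrightarrow> \<alpha> * cinner_vec (A *v x) u = \<beta> * cinner_vec (conj_transpose A *v x) u"
    using iso by (auto simp: isotropic_eigenvector_def)
  obtain F where F: "finite F" "\<And>w. norm w = 1 \<Longrightarrow> w \<notin> F \<Longrightarrow>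
     \<exists>V. vec.subspace V \<and> V \<subseteq> U \<and> k \<le> vec.dim V \<and> nonneg_on w A V"
    using pos by (auto simp: generically_nonneg_def)
  define X where "X = {u \<in> U. cinner_vec (A *v x) u = 0 \<and> cinner_vec (A *v u) x = 0}"
  have X: "vec.subspace X" 
    using U by (auto simp: X_def vec.subspace_def cinner_simps matrix_vector_right_distrib vector_scalar_commute)
  have XU: "X \<subseteq> U" and xX: "x \<in> X" using x by (auto simp: X_def)
  have conjeq: "cinner_vec (conj_transpose A *v x) u = 0 \<longleftrightarrow> cinner_vec (A *v u) x = 0" for u
    by (simp add: cinner_adjoint_left)
  obtain y where y: "X = {u \<in> U. cinner_vec u y = 0}"
  proof (cases "\<alpha> = 0")
    case False
    then have "cinner_vec (A *v x) u = 0" if "u \<in> U" "cinner_vec (A *v u) x = 0" for u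
      using lin[OF that(1)] that(2) conjeq[of u] by simp
    then have "X = {u \<in> U. cinner_vec u (conj_transpose A *v x) = 0}"
      unfolding X_def by (auto simp flip: cinner_adjoint)
    then show ?thesis by (rule that)
  next
    case True
    then have "cinner_vec (A *v u) x = 0" if "u \<in> U" for u
      using lin[OF that] ab conjeq[of u] by simp
    then have "X = {u \<in> U. cinner_vec u (A *v x) = 0}"
      unfolding X_def by (auto simp: cinner_eq_0_commute[of _ "A *v x"])
    then show ?thesis by (rule that)
  qed
  \<comment> \<open>\<open>G\<close> consists of the directions for which \<open>x\<close> is in the radical of the Hermitian part.\<close>
  obtain G where G: "finite G" "\<And>w V. norm w = 1 \<Longrightarrow> w \<notin> G \<Longrightarrow> vec.subspace V \<Longrightarrow> V \<subseteq> U
      \<Longrightarrow> nonneg_on w A V \<Longrightarrow> x \<in> V \<Longrightarrow> V \<subseteq> X"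
  proof (cases "X = U")
    case True
    then show ?thesis using that[of "{}"] by simp
  next
    case False
    then obtain u0 where u0: "u0 \<in> U" "u0 \<notin> X" using XU by blast
    define c where "c = cinner_vec (A *v x) u0"
    define c' where "c' = cinner_vec (conj_transpose A *v x) u0"
    have cc: "c \<noteq> 0 \<or> c' \<noteq> 0" using u0 conjeq by (auto simp: X_def c_def c'_def)
    \<comment> \<open>For unimodular \<open>w\<close>, multiplying the value \<open>w * c + cnj w * c'\<close> by \<open>w\<close> gives this
      polynomial.\<close>
    let ?p = "[:c', 0, c:]"
    have "finite {w. poly ?p w = 0}" using cc by (intro poly_roots_finite) auto
    moreover have "V \<subseteq> X" if w: "norm w = 1" "w \<notin> {w. poly ?p w = 0}" and V: "vec.subspace V" "V \<subseteq> U"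
      "nonneg_on w A V" "x \<in> V" for w V
    proof
      fix v assume v: "v \<in> V"
      define p where "p = cinner_vec (A *v x) v"
      define q where "q = cinner_vec (conj_transpose A *v x) v"
      have ww: "w * cnj w = 1" using w(1) complex_norm_square[of w] by simp
      have pq: "w * p + cnj w * q = 0"
        unfolding p_def q_def by (rule nonneg_on_isotropic_radical[OF V(1,3,4) x(3) v])
      have "w * (w * c + cnj w * c') = w * (w * c) + (w * cnj w) * c'" by (simp only: algebra_simps)
      then have h: "w * (w * c + cnj w * c') \<noteq> 0"
        using w(2) ww by (simp add: algebra_simps)
      have 1: "\<alpha> * c = \<beta> * c'" "\<alpha> * p = \<beta> * q"
        using lin u0 v V(2) by (auto simp: c_def c'_def p_def q_def)
      \<comment> \<open>The pairs \<open>(c, c')\<close> and \<open>(p, q)\<close> satisfy the same nontrivial linear equation, so they are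
        proportional.\<close>
      have pcqc: "p * c' = q * c"
      proof (cases "\<alpha> = 0")
        case True
        then show ?thesis using 1 ab by simp
      next
        case False
        have "\<alpha> * (p * c') = \<beta> * q * c'" using 1 by (simp flip: mult.assoc)
        also have "\<dots> = \<alpha> * (q * c)" using 1(1) by (simp add: mult_ac)
        finally show ?thesis using False by simp
      qed
      have "p * (w * c + cnj w * c') = c * (w * p + cnj w * q)"
        using pcqc by (simp add: algebra_simps)
      moreover have "q * (w * c + cnj w * c') = c' * (w * p + cnj w * q)"
        using pcqc by (simp add: algebra_simps)
      ultimately have "p = 0" "q = 0" using pq h by auto
      then show "v \<in> X" using v V(2) conjeq by (auto simp: X_def p_def q_def)
    qed
    ultimately show ?thesis using that by blast
  qed
  define U' where "U' = {u \<in> X. cinner_vec u x = 0}"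
  have U': "vec.subspace U'"
    using X by (auto simp: U'_def vec.subspace_def cinner_simps)
  have "\<exists>V. vec.subspace V \<and> V \<subseteq> U' \<and> k - 1 \<le> vec.dim V \<and> nonneg_on w A V"
    if w: "norm w = 1" "w \<notin> F \<union> G" for w
  proof -
    obtain V where V: "vec.subspace V" "V \<subseteq> U" "k \<le> vec.dim V" "nonneg_on w A V"
      using F w by blast
    define W where "W = V \<inter> X"
    have W: "vec.subspace W" using V X by (simp add: W_def vec.subspace_inter)
    \<comment> \<open>Adding \<open>x\<close> does not harm nonnegativity, and makes up for the dimension lost to \<open>X\<close> unless
      \<open>x\<close> was there already, when nothing had been lost.\<close>
    define W' where "W' = vec.span (insert x W)"
    have spanW: "vec.span W = W" using W vec.span_eq_iff by blast
    have Wdim: "vec.dim V \<le> vec.dim W + 1"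
    proof -
      have "W = {v \<in> V. cinner_vec v y = 0}" using V(2) by (auto simp: W_def y)
      then show ?thesis using dim_Int_hyperplane[OF V(1)] by simp
    qed
    have "k \<le> vec.dim W'"
    proof (cases "x \<in> V")
      case True
      then have "V \<subseteq> W'" using G(2)[OF w(1) _ V(1,2,4)] w(2) vec.span_superset[of "insert x W"]
        by (auto simp: W_def W'_def)
      then show ?thesis using vec.dim_subset[of V W'] V(3) by simp
    next
      case False
      then have "x \<notin> vec.span W" by (simp add: spanW) (simp add: W_def)
      then show ?thesis using Wdim V(3) by (simp add: W'_def vec.dim_insert)
    qed
    moreover have W'sub: "vec.subspace W'" by (simp add: W'_def)
    ultimately have "k - 1 \<le> vec.dim {v \<in> W'. cinner_vec v x = 0}"
      using dim_Int_hyperplane[OF W'sub, of x] by linarith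
    moreover have "vec.subspace {v \<in> W'. cinner_vec v x = 0}"
      using W'sub by (auto simp: vec.subspace_def cinner_simps)
    moreover have "W' \<subseteq> X"
      unfolding W'_def using X xX by (intro vec.span_minimal) (auto simp: W_def)
    then have "{v \<in> W'. cinner_vec v x = 0} \<subseteq> U'" by (auto simp: U'_def)
    moreover have "nonneg_on w A W'"
      unfolding nonneg_on_def
    proof
      fix v assume "v \<in> W'"
      then obtain s where "v - s *s x \<in> vec.span W" by (auto simp: W'_def vec.span_insert)
      then have z: "v - s *s x \<in> W" by (simp add: spanW)
      define z where "z = v - s *s x"
      have "v = z + s *s x" "z \<in> X" "z \<in> V" using z by (auto simp: z_def W_def)
      moreover have "cinner_vec (A *v (z + s *s x)) (z + s *s x) = cinner_vec (A *v z) z"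
        unfolding form_add_scaled using \<open>z \<in> X\<close> x(3) by (simp add: X_def)
      ultimately show "0 \<le> Re (w * cinner_vec (A *v v) v)"
        using V(4) by (simp add: nonneg_on_def)
    qed
    then have "nonneg_on w A {v \<in> W'. cinner_vec v x = 0}" by (simp add: nonneg_on_def)
    ultimately show ?thesis by blast
  qed
  then have "generically_nonneg A U' (k - 1)"
    unfolding generically_nonneg_def using F(1) G(1) by (intro exI[of _ "F \<union> G"]) auto
  moreover have "x \<notin> U'" using x(2) by (simp add: U'_def)
  moreover have "U' \<subseteq> U" using XU by (auto simp: U'_def)
  moreover have "cinner_vec (A *v x) u = 0 \<and> cinner_vec (A *v u) x = 0" if "u \<in> U'" for u
    using that by (simp add: U'_def X_def)
  ultimately show ?thesis by (intro that[OF U'])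
qed

section \<open>Interlacing sequences and compressions of diagonal matrices\<close>

text \<open>The interlacing \<open>n i < p i < n (i + e)\<close> decouples into chains, one for each
  residue class modulo \<open>e\<close>, and each chain is a strictly increasing alternation of values
  of \<open>n\<close> and of \<open>p\<close>. Nothing is said about the relative order of values in
  different classes.\<close>
context
  fixes n p :: "nat \<Rightarrow> real" and e k :: nat
  assumes interlace: "\<And>i. i < k \<Longrightarrow> n i < p i \<and> p i < n (i + e)"
begin

lemma interlace_mono: "j + e * m < k + e \<Longrightarrow> n j \<le> n (j + e * m)"
proof (induction m)
  case (Suc m)
  then have "j + e * m < k" by simp
  then show ?case using interlace[of "j + e * m"] Suc by (simp add: algebra_simps)
qed simp

lemma interlace_before:
  assumes "i < k" "j \<le> i" "j mod e = i mod e"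
  shows "n j < p i"
proof -
  have "e dvd i - j" using assms mod_eq_dvd_iff_nat[of j i e] by simp
  then obtain m where "i - j = e * m" ..
  then have i: "i = j + e * m" using assms(2) by simp
  then have "n j \<le> n i" using interlace_mono[of j m] assms(1) by simp
  then show ?thesis using interlace[OF assms(1)] by simp
qed

lemma interlace_after:
  assumes "i < j" "j < k + e" "j mod e = i mod e"
  shows "p i < n j"
proof -
  have "e dvd j - i" using assms mod_eq_dvd_iff_nat[of i j e] by simp
  then obtain m where m: "j - i = e * m" ..
  then obtain m' where "m = Suc m'" using assms(1) by (cases m) auto
  then have j: "j = i + e + e * m'" using assms(1) m by simp
  then have "n (i + e) \<le> n j" "i < k" using interlace_mono[of "i + e" m'] assms(2) by simp_all
  then show ?thesis using interlace[of i] by simp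
qed

end

lemma partial_fraction_identity:
  fixes P N a b :: real
  assumes "N \<noteq> a" "a \<noteq> b" "N \<noteq> b"
  shows "((P - a) / (N - a)) / (a - b) = ((P - b) / (N - b)) / (a - b) + ((P - N) / (N - b)) / (N - a)"
  using assms by (simp add: divide_simps) (simp add: algebra_simps)

text \<open>For one class, the condition says that the rational function \<open>\<Sum>j. W j / (n j -
  x)\<close> with poles at the values of \<open>n\<close> has its zeros at the values of
  \<open>p\<close>; positivity of the weights reflects the interlacing of zeros and poles. The induction
  on \<open>k\<close> multiplies the rational function by \<open>(P - x) / (N - x)\<close>, which adds
  the zero \<open>P\<close> and the pole \<open>N\<close>.\<close>
lemma interlacing_weights:
  fixes n p :: "nat \<Rightarrow> real"
  assumes "0 < e" "\<And>i. i < k \<Longrightarrow> n i < p i \<and> p i < n (i + e)"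
  shows "\<exists>W. (\<forall>j. 0 < W j) \<and>
    (\<forall>i<k. (\<Sum>j\<in>{j. j < k + e \<and> j mod e = i mod e}. W j / (n j - p i)) = 0)"
  using assms(2)
proof (induction k)
  case 0
  show ?case by (rule exI[of _ "\<lambda>_. 1"]) simp
next
  case (Suc k)
  define C where "C r = {j. j < k + e \<and> j mod e = r}" for r
  have finC: "finite (C r)" for r by (simp add: C_def)
  obtain W where W: "\<And>j. 0 < W j" "\<And>i. i < k \<Longrightarrow> (\<Sum>j\<in>C (i mod e). W j / (n j - p i)) = 0"
    using Suc.IH[OF Suc.prems[OF less_SucI]] unfolding C_def by auto
  define N where "N = n (k + e)"
  define P where "P = p k"
  let ?C = "C (k mod e)"
  have step: "{j. j < Suc (k + e) \<and> j mod e = r} = (if r = k mod e then insert (k + e) (C r) else C r)" for r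
    by (auto simp: C_def less_Suc_eq)
  have notin: "k + e \<notin> C r" for r by (simp add: C_def)
  have before: "n j < P" if "j \<in> ?C" for j
  proof -
    have "j \<le> k"
    proof (rule ccontr)
      assume "\<not> j \<le> k"
      then have "e dvd j - k" "k < j" using that mod_eq_dvd_iff_nat[of k j e] by (auto simp: C_def)
      moreover have "j < k + e" using that by (simp add: C_def)
      ultimately show False using dvd_imp_le[of e "j - k"] by linarith
    qed
    then show ?thesis
      using interlace_before[of "Suc k" n p e k j] Suc.prems that by (simp add: P_def C_def)
  qed
  have PN: "P < N" using Suc.prems[of k] by (simp add: P_def N_def)
  define S where "S = (\<Sum>j\<in>?C. W j / (N - n j))"
  have "0 < S"
  proof -
    have "k \<in> ?C" using assms(1) by (simp add: C_def)
    then show ?thesis unfolding S_def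
      using W(1) before PN finC by (intro sum_pos) (force intro!: divide_pos_pos)+
  qed
  define W' where "W' j = (if j = k + e then (N - P) * S
     else if j \<in> ?C then W j * ((P - n j) / (N - n j)) else W j)" for j
  have pos: "0 < W' j" for j
    using W(1)[of j] \<open>0 < S\<close> PN before[of j] by (auto simp: W'_def intro!: mult_pos_pos divide_pos_pos)
  have last: "(\<Sum>j\<in>insert (k + e) ?C. W' j / (n j - q)) =
      (\<Sum>j\<in>?C. W j * ((P - n j) / (N - n j)) / (n j - q)) + (N - P) * S / (N - q)" for q
  proof -
    have "(\<Sum>j\<in>?C. W' j / (n j - q)) = (\<Sum>j\<in>?C. W j * ((P - n j) / (N - n j)) / (n j - q))"
      by (rule sum.cong) (auto simp: W'_def C_def)
    then show ?thesis using notin finC by (simp add: W'_def N_def)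
  qed
  have "(\<Sum>j\<in>{j. j < Suc k + e \<and> j mod e = i mod e}. W' j / (n j - p i)) = 0" if i: "i < Suc k" for i
  proof (cases "i mod e = k mod e")
    case False
    then have "(\<Sum>j\<in>C (i mod e). W' j / (n j - p i)) = (\<Sum>j\<in>C (i mod e). W j / (n j - p i))"
      by (intro sum.cong) (auto simp: W'_def C_def)
    moreover have "i < k" using False i less_Suc_eq by blast
    ultimately show ?thesis using False W(2)[of i] by (simp add: step)
  next
    case same: True
    show ?thesis
    proof (cases "i = k")
      case True
      have "(\<Sum>j\<in>?C. W j * ((P - n j) / (N - n j)) / (n j - P)) = (\<Sum>j\<in>?C. - (W j / (N - n j)))"
      proof (rule sum.cong)
        fix j assume "j \<in> ?C"
        then have "n j < P" by (rule before)
        then have "(P - n j) / (n j - P) = -1" by (simp add: divide_simps)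
        then have "W j / (N - n j) * ((P - n j) / (n j - P)) = - (W j / (N - n j))" by simp
        then show "W j * ((P - n j) / (N - n j)) / (n j - P) = - (W j / (N - n j))" by simp
      qed simp
      then have "(\<Sum>j\<in>?C. W j * ((P - n j) / (N - n j)) / (n j - P)) = - S"
        by (simp add: S_def sum_negf)
      then show ?thesis using True PN last[of P] by (simp add: step P_def)
    next
      case False
      then have ik: "i < k" using i by simp
      define q where "q = p i"
      have qN: "q < N"
        using interlace_after[of "Suc k" n p e i "k + e"] Suc.prems ik same by (simp add: q_def N_def)
      have nq: "n j \<noteq> q" if "j \<in> ?C" for j
      proof (cases "j \<le> i")
        case True
        then show ?thesis
          using interlace_before[of "Suc k" n p e i j] Suc.prems that same ik by (auto simp: q_def C_def)
      next
        case False
        then show ?thesis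
          using interlace_after[of "Suc k" n p e i j] Suc.prems that same ik by (auto simp: q_def C_def)
      qed
      have "(\<Sum>j\<in>?C. W j * ((P - n j) / (N - n j)) / (n j - q)) =
        (\<Sum>j\<in>?C. ((P - q) / (N - q)) * (W j / (n j - q)) + ((P - N) / (N - q)) * (W j / (N - n j)))"
      proof (rule sum.cong)
        fix j assume "j \<in> ?C"
        then have "((P - n j) / (N - n j)) / (n j - q) =
           ((P - q) / (N - q)) / (n j - q) + ((P - N) / (N - q)) / (N - n j)"
          using partial_fraction_identity[of N "n j" q P] before[of j] PN qN nq[of j] by fastforce
        then have "W j * (((P - n j) / (N - n j)) / (n j - q)) =
           W j * (((P - q) / (N - q)) / (n j - q) + ((P - N) / (N - q)) / (N - n j))" by simp
        then show "W j * ((P - n j) / (N - n j)) / (n j - q) =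
           ((P - q) / (N - q)) * (W j / (n j - q)) + ((P - N) / (N - q)) * (W j / (N - n j))"
          by (simp add: algebra_simps)
      qed simp
      also have "\<dots> = ((P - q) / (N - q)) * (\<Sum>j\<in>?C. W j / (n j - q)) + ((P - N) / (N - q)) * S"
        by (simp add: sum.distrib sum_distrib_left S_def)
      also have "(\<Sum>j\<in>?C. W j / (n j - q)) = 0" using W(2)[OF ik] same by (simp add: q_def)
      finally have "(\<Sum>j\<in>?C. W j * ((P - n j) / (N - n j)) / (n j - q)) = ((P - N) / (N - q)) * S"
        by simp
      moreover have "((P - N) / (N - q)) * S + (N - P) * S / (N - q) = 0"
        by (simp add: algebra_simps flip: add_divide_distrib)
      ultimately show ?thesis using last[of q] same by (simp add: step q_def)
    qed
  qed
  then show ?case using pos by blast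
qed

text \<open>The converse of Cauchy's interlacing theorem (Fan and Pall): the rows of \<open>y\<close>
  are orthonormal and compress the diagonal matrix with entries \<open>n\<close> to the one with entries
  \<open>p\<close>. As for the eigenvectors of a rank one perturbation of a diagonal matrix, the entries
  of the rows are \<open>sqrt (W j) / (n j - p i)\<close> up to normalisation, supported on the class of
  \<open>i\<close>. Both relations then reduce, by partial fractions, to the vanishing of the sums in
  the previous lemma.\<close>
lemma interlacing_compression:
  fixes n p :: "nat \<Rightarrow> real"
  assumes e: "0 < e" and int: "\<And>i. i < k \<Longrightarrow> n i < p i \<and> p i < n (i + e)"
  obtains y where
    "\<And>i i'. i < k \<Longrightarrow> i' < k \<Longrightarrow> (\<Sum>j<k+e. y i j * y i' j) = (if i = i' then 1 else 0)"
    "\<And>i i'. i < k \<Longrightarrow> i' < k \<Longrightarrow> (\<Sum>j<k+e. n j * (y i j * y i' j)) = (if i = i' then p i else (0::real))"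
proof -
  define C where "C r = {j. j < k + e \<and> j mod e = r}" for r
  have finC: "finite (C r)" for r by (simp add: C_def)
  obtain W where W: "\<And>j. 0 < W j" "\<And>i. i < k \<Longrightarrow> (\<Sum>j\<in>C (i mod e). W j / (n j - p i)) = 0"
    using interlacing_weights[of e k n p, OF e int] unfolding C_def by blast
  have before: "n j < p i" if "i < k" "j \<le> i" "j mod e = i mod e" for i j
    using interlace_before[of k n p e i j, OF int] that by simp
  have after: "p i < n j" if "i < j" "j < k + e" "j mod e = i mod e" for i j
    using interlace_after[of k n p e i j, OF int] that by simp
  have np: "n j \<noteq> p i" if "i < k" "j \<in> C (i mod e)" for i j
    using before[of i j] after[of i j] that by (cases "j \<le> i") (auto simp: C_def)
  define s where "s i = (\<Sum>j\<in>C (i mod e). W j / (n j - p i)\<^sup>2)" for i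
  have s: "0 < s i" if "i < k" for i
    unfolding s_def
  proof (rule sum_pos)
    show "C (i mod e) \<noteq> {}" using that e by (auto simp: C_def intro!: exI[of _ i])
    show "0 < W j / (n j - p i)\<^sup>2" if "j \<in> C (i mod e)" for j
      using W(1)[of j] np[OF \<open>i < k\<close> that] by simp
  qed (rule finC)
  define y where "y i j = (if j \<in> C (i mod e) then sqrt (W j) / (sqrt (s i) * (n j - p i)) else 0)" for i j
  have yy: "y i j * y i' j = (if j \<in> C (i mod e) then
      (1 / (sqrt (s i) * sqrt (s i'))) * (W j / ((n j - p i) * (n j - p i'))) else 0)"
    if "i mod e = i' mod e" for i i' j
    using W(1)[of j] that by (simp add: y_def)
  have yy0: "y i j * y i' j = 0" if "i mod e \<noteq> i' mod e" for i i' j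
    using that by (auto simp: y_def C_def)
  have sumC: "(\<Sum>j<k+e. if j \<in> C r then f j else 0) = (\<Sum>j\<in>C r. f j)" for f :: "nat \<Rightarrow> real" and r
  proof -
    have "(\<Sum>j<k+e. if j \<in> C r then f j else 0) = (\<Sum>j\<in>{..<k+e} \<inter> C r. f j)"
      by (simp add: sum.inter_restrict)
    also have "{..<k+e} \<inter> C r = C r" by (auto simp: C_def)
    finally show ?thesis .
  qed
  have orth: "(\<Sum>j<k+e. y i j * y i' j) = (if i = i' then 1 else 0)" if i: "i < k" "i' < k" for i i'
  proof (cases "i mod e = i' mod e")
    case False
    then show ?thesis by (auto simp: yy0)
  next
    case True
    have eq: "(\<Sum>j<k+e. y i j * y i' j) =
      (1 / (sqrt (s i) * sqrt (s i'))) * (\<Sum>j\<in>C (i mod e). W j / ((n j - p i) * (n j - p i')))"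
      by (simp add: yy[OF True] sumC sum_distrib_left)
    show ?thesis
    proof (cases "i = i'")
      case True
      have "(\<Sum>j\<in>C (i mod e). W j / ((n j - p i) * (n j - p i))) = s i"
        by (simp add: s_def power2_eq_square)
      then show ?thesis using eq True s[OF i(1)] by simp
    next
      case ne: False
      have pne: "p i \<noteq> p i'"
      proof (cases "i < i'")
        case True
        then show ?thesis using after[of i i'] before[of i' i'] i \<open>i mod e = i' mod e\<close> by force
      next
        case False
        then show ?thesis using after[of i' i] before[of i i] i \<open>i mod e = i' mod e\<close> ne by force
      qed
      have "(p i - p i') * (\<Sum>j\<in>C (i mod e). W j / ((n j - p i) * (n j - p i'))) =
        (\<Sum>j\<in>C (i mod e). W j / (n j - p i) - W j / (n j - p i'))"
        unfolding sum_distrib_left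
      proof (rule sum.cong)
        fix j assume "j \<in> C (i mod e)"
        then have "n j \<noteq> p i" "n j \<noteq> p i'" using np i True by auto
        then show "(p i - p i') * (W j / ((n j - p i) * (n j - p i'))) = W j / (n j - p i) - W j / (n j - p i')"
          by (simp add: divide_simps) (simp add: algebra_simps)
      qed simp
      also have "\<dots> = 0" using W(2)[OF i(1)] W(2)[OF i(2)] True by (simp add: sum_subtractf)
      finally show ?thesis using eq pne ne by simp
    qed
  qed
  have "(\<Sum>j<k+e. n j * (y i j * y i' j)) = (if i = i' then p i else 0)" if i: "i < k" "i' < k" for i i'
  proof -
    have "(\<Sum>j<k+e. (n j - p i) * (y i j * y i' j)) = 0"
    proof (cases "i mod e = i' mod e")
      case False
      then show ?thesis by (simp add: yy0)
    next
      case True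
      have "(\<Sum>j<k+e. (n j - p i) * (y i j * y i' j)) = (\<Sum>j<k+e. if j \<in> C (i mod e) then
         (1 / (sqrt (s i) * sqrt (s i'))) * (W j / (n j - p i')) else 0)"
        by (rule sum.cong) (use np[OF i(1)] in \<open>auto simp: yy[OF True]\<close>)
      also have "\<dots> = (1 / (sqrt (s i) * sqrt (s i'))) * (\<Sum>j\<in>C (i mod e). W j / (n j - p i'))"
        by (simp add: sumC sum_distrib_left)
      finally show ?thesis using W(2)[OF i(2)] True by simp
    qed
    moreover have "(\<Sum>j<k+e. (n j - p i) * (y i j * y i' j)) =
        (\<Sum>j<k+e. n j * (y i j * y i' j)) - p i * (\<Sum>j<k+e. y i j * y i' j)"
      by (simp add: left_diff_distrib sum_subtractf sum_distrib_left)
    ultimately show ?thesis using orth[OF i] by simp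
  qed
  then show ?thesis using orth that by blast
qed

lemma sorted_enumeration:
  fixes t :: "'a \<Rightarrow> real"
  assumes "finite S"
  obtains f where "bij_betw f {..<card S} S" "\<And>i j. i \<le> j \<Longrightarrow> j < card S \<Longrightarrow> t (f i) \<le> t (f j)"
proof -
  obtain xs0 where xs0: "set xs0 = S" "distinct xs0" using finite_distinct_list[OF assms] by blast
  define xs where "xs = sort_key t xs0"
  have xs: "set xs = S" "distinct xs" "sorted (map t xs)" using xs0 by (simp_all add: xs_def)
  have len: "length xs = card S" using xs distinct_card by fastforce
  have "bij_betw ((!) xs) {..<card S} S" using bij_betw_nth[OF xs(2)] xs(1) len by simp
  moreover have "t (xs ! i) \<le> t (xs ! j)" if "i \<le> j" "j < card S" for i j
    using sorted_nth_mono[OF xs(3), of i j] that len by simp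
  ultimately show ?thesis by (rule that)
qed

section \<open>Points in the plane that no half-plane avoids\<close>

lemma finite_circle_roots:
  fixes z :: complex
  assumes "z \<noteq> 0"
  shows "finite {w. norm w = 1 \<and> Re (w * z) = 0}"
proof -
  have "poly [:cnj z, 0, z:] w = 0" if "norm w = 1" "Re (w * z) = 0" for w
  proof -
    have "w * cnj w = 1" using that(1) complex_norm_square[of w] by simp
    moreover have "w * z + cnj (w * z) = 0"
      unfolding complex_add_cnj that(2) by simp
    then have "w * z + cnj w * cnj z = 0" by simp
    then have "w * (w * z + cnj w * cnj z) = 0" by simp
    then have "w * (w * z) + (w * cnj w) * cnj z = 0" by (simp only: algebra_simps)
    ultimately show ?thesis by (simp add: algebra_simps)
  qed
  then have "{w. norm w = 1 \<and> Re (w * z) = 0} \<subseteq> {w. poly [:cnj z, 0, z:] w = 0}" by blast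
  moreover have "finite {w. poly [:cnj z, 0, z:] w = 0}" using assms by (intro poly_roots_finite) simp
  ultimately show ?thesis by (rule finite_subset)
qed

text \<open>These points parametrise the open upper half of the unit circle. Multiplication by
  \<open>unit_of_slope \<tau>\<close> turns the comparison of \<open>\<tau>\<close> with the slope of a
  point into the sign of a real part.\<close>
definition unit_of_slope :: "real \<Rightarrow> complex" where
  "unit_of_slope \<tau> = Complex \<tau> 1 / of_real (norm (Complex \<tau> 1))"

lemma norm_Complex_pos: "0 < norm (Complex \<tau> 1)"
  by (simp add: complex_eq_iff)

lemma norm_unit_of_slope: "norm (unit_of_slope \<tau>) = 1"
  using norm_Complex_pos[of \<tau>] by (simp add: unit_of_slope_def norm_divide)

lemma inj_unit_of_slope: "inj unit_of_slope"
proof (rule injI)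
  fix a b assume eq: "unit_of_slope a = unit_of_slope b"
  have Im: "Im (unit_of_slope \<tau>) = 1 / norm (Complex \<tau> 1)" and Re: "Re (unit_of_slope \<tau>) = \<tau> / norm (Complex \<tau> 1)" for \<tau>
    by (simp_all add: unit_of_slope_def Im_divide_of_real Re_divide_of_real)
  have "1 / norm (Complex a 1) = 1 / norm (Complex b 1)" unfolding Im[symmetric] eq ..
  moreover have "a / norm (Complex a 1) = b / norm (Complex b 1)" unfolding Re[symmetric] eq ..
  ultimately have "a * (1 / norm (Complex b 1)) = b * (1 / norm (Complex b 1))" by simp
  then show "a = b" using norm_Complex_pos[of b] by (simp only: mult_cancel_right) simp
qed

lemma Re_unit_of_slope_mult: "Re (unit_of_slope \<tau> * \<zeta>) = (\<tau> * Re \<zeta> - Im \<zeta>) / norm (Complex \<tau> 1)"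
  by (simp add: unit_of_slope_def Re_divide_of_real diff_divide_distrib)

text \<open>Among the directions that are not exceptional choose \<open>w\<close> so that as few points
  as possible, say \<open>k'\<close>, have positive real part after rotation by \<open>w\<close>. List
  the points with positive real part as \<open>f\<close> and those with negative real part as
  \<open>g\<close>, in the order of their slopes. The half-plane cut out by the line of slope
  \<open>\<tau>\<close> contains the points of \<open>f\<close> with slope on one side of
  \<open>\<tau>\<close> and the points of \<open>g\<close> with slope on the other side. If one of the
  interlacing inequalities failed, a slope \<open>\<tau>\<close> in between would give a half-plane with
  fewer than \<open>k'\<close> points, against minimality. The inequalities are strict because points of
  \<open>f\<close> and \<open>g\<close> with the same slope are opposite, which \<open>opp\<close>
  excludes.\<close>
lemma circle_configuration:
  fixes z :: "'a \<Rightarrow> complex"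
  assumes B: "finite B" and z0: "\<And>b. b \<in> B \<Longrightarrow> z b \<noteq> 0"
    and opp: "\<And>b b' s. b \<in> B \<Longrightarrow> b' \<in> B \<Longrightarrow> 0 < s \<Longrightarrow> z b + of_real s * z b' \<noteq> 0"
    and F: "finite F"
    and count: "\<And>w. norm w = 1 \<Longrightarrow> w \<notin> F \<Longrightarrow> k \<le> card {b \<in> B. 0 \<le> Re (w * z b)}"
  obtains w k' e f g where "norm w = 1" "k \<le> k'"
    "bij_betw f {..<k'} {b \<in> B. 0 < Re (w * z b)}"
    "bij_betw g {..<k' + e} {b \<in> B. Re (w * z b) < 0}"
    "\<And>b. b \<in> B \<Longrightarrow> Re (w * z b) \<noteq> 0"
    "\<And>i. i < k' \<Longrightarrow> Im (w * z (g i)) / Re (w * z (g i)) < Im (w * z (f i)) / Re (w * z (f i)) \<and>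
       Im (w * z (f i)) / Re (w * z (f i)) < Im (w * z (g (i + e))) / Re (w * z (g (i + e)))"
proof -
  define F' where "F' = F \<union> (\<Union>b\<in>B. {w. norm w = 1 \<and> Re (w * z b) = 0})"
  have F': "finite F'" using F B z0 finite_circle_roots by (auto simp: F'_def)
  define ct where "ct w = card {b \<in> B. 0 < Re (w * z b)}" for w
  define \<Gamma> where "\<Gamma> = {w. norm w = 1 \<and> w \<notin> F'}"
  have nz: "Re (w * z b) \<noteq> 0" if "w \<in> \<Gamma>" "b \<in> B" for w b
    using that by (auto simp: \<Gamma>_def F'_def)
  have kct: "k \<le> ct w" if "w \<in> \<Gamma>" for w
  proof -
    have "{b \<in> B. 0 \<le> Re (w * z b)} = {b \<in> B. 0 < Re (w * z b)}"
      using nz[OF that] by force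
    then show ?thesis using count[of w] that by (simp add: ct_def \<Gamma>_def F'_def)
  qed
  have "infinite (range unit_of_slope)" using inj_unit_of_slope finite_imageD infinite_UNIV_char_0 by blast
  then have "\<not> range unit_of_slope \<subseteq> F'" using F' finite_subset by blast
  then have "\<exists>w. w \<in> \<Gamma>" using norm_unit_of_slope by (auto simp: \<Gamma>_def)
  then obtain w where w: "w \<in> \<Gamma>" and least: "\<And>w'. w' \<in> \<Gamma> \<Longrightarrow> ct w \<le> ct w'"
    using ex_has_least_nat[of "\<lambda>w. w \<in> \<Gamma>" _ ct] by blast
  define \<zeta> where "\<zeta> b = w * z b" for b
  define x where "x b = Re (\<zeta> b)" for b
  define t where "t b = Im (\<zeta> b) / Re (\<zeta> b)" for b
  have x0: "x b \<noteq> 0" if "b \<in> B" for b using nz[OF w that] by (simp add: x_def \<zeta>_def)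
  have Imt: "Im (\<zeta> b) = t b * x b" if "b \<in> B" for b using x0[OF that] by (simp add: t_def flip: x_def)
  define P where "P = {b \<in> B. 0 < x b}"
  define N where "N = {b \<in> B. x b < 0}"
  have fin: "finite P" "finite N" using B by (simp_all add: P_def N_def)
  define k' where "k' = card P"
  have k': "k' = ct w" by (simp add: k'_def P_def ct_def x_def \<zeta>_def)
  have normw: "norm w = 1" using w by (simp add: \<Gamma>_def)
  then have "w \<noteq> 0" by auto
  define T where "T = {\<tau>. unit_of_slope \<tau> * w \<in> F' \<or> - (unit_of_slope \<tau> * w) \<in> F'}"
  have "inj (\<lambda>\<tau>. unit_of_slope \<tau> * w)" "inj (\<lambda>\<tau>. - (unit_of_slope \<tau> * w))"
    using inj_unit_of_slope \<open>w \<noteq> 0\<close> by (auto simp: inj_def)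
  then have "finite ((\<lambda>\<tau>. unit_of_slope \<tau> * w) -` F')" "finite ((\<lambda>\<tau>. - (unit_of_slope \<tau> * w)) -` F')"
    using F' finite_vimageI by blast+
  then have T: "finite T" by (simp add: T_def vimage_def Collect_disj_eq)
  have sgn: "0 < Re (unit_of_slope \<tau> * w * z b) \<longleftrightarrow> 0 < x b * (\<tau> - t b)"
    "0 < Re (- (unit_of_slope \<tau> * w) * z b) \<longleftrightarrow> x b * (\<tau> - t b) < 0" if "b \<in> B" for \<tau> b
  proof -
    have "Re (unit_of_slope \<tau> * w * z b) = Re (unit_of_slope \<tau> * \<zeta> b)" by (simp only: \<zeta>_def mult.assoc)
    also have "\<dots> = (x b * (\<tau> - t b)) / norm (Complex \<tau> 1)"
      unfolding Re_unit_of_slope_mult Imt[OF that] by (simp add: x_def algebra_simps)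
    finally have eq: "Re (unit_of_slope \<tau> * w * z b) = (x b * (\<tau> - t b)) / norm (Complex \<tau> 1)" .
    moreover have "Re (- (unit_of_slope \<tau> * w) * z b) = - Re (unit_of_slope \<tau> * w * z b)"
      by (simp only: mult_minus_left uminus_complex.sel)
    ultimately show "0 < Re (unit_of_slope \<tau> * w * z b) \<longleftrightarrow> 0 < x b * (\<tau> - t b)"
      "0 < Re (- (unit_of_slope \<tau> * w) * z b) \<longleftrightarrow> x b * (\<tau> - t b) < 0"
      using norm_Complex_pos[of \<tau>]
      by (simp_all only: zero_less_divide_iff divide_less_0_iff neg_0_less_iff_less) auto
  qed
  have below: "k' \<le> card {b \<in> P. t b < \<tau>} + card {b \<in> N. \<tau> < t b}" if "\<tau> \<notin> T" for \<tau>
  proof -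
    have "unit_of_slope \<tau> * w \<in> \<Gamma>" using that norm_unit_of_slope normw by (simp add: \<Gamma>_def T_def norm_mult)
    then have "k' \<le> ct (unit_of_slope \<tau> * w)" using least k' by simp
    also have "{b \<in> B. 0 < Re (unit_of_slope \<tau> * w * z b)} = {b \<in> P. t b < \<tau>} \<union> {b \<in> N. \<tau> < t b}"
      using sgn(1) by (auto simp: P_def N_def zero_less_mult_iff)
    then have "ct (unit_of_slope \<tau> * w) \<le> card {b \<in> P. t b < \<tau>} + card {b \<in> N. \<tau> < t b}"
      unfolding ct_def by (simp add: card_Un_le)
    finally show ?thesis .
  qed
  have above: "k' \<le> card {b \<in> P. \<tau> < t b} + card {b \<in> N. t b < \<tau>}" if "\<tau> \<notin> T" for \<tau>
  proof -
    have "- (unit_of_slope \<tau> * w) \<in> \<Gamma>" using that norm_unit_of_slope normw by (simp add: \<Gamma>_def T_def norm_mult)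
    then have "k' \<le> ct (- (unit_of_slope \<tau> * w))" using least k' by simp
    also have "{b \<in> B. 0 < Re (- (unit_of_slope \<tau> * w) * z b)} = {b \<in> P. \<tau> < t b} \<union> {b \<in> N. t b < \<tau>}"
      using sgn(2) by (auto simp: P_def N_def mult_less_0_iff)
    then have "ct (- (unit_of_slope \<tau> * w)) \<le> card {b \<in> P. \<tau> < t b} + card {b \<in> N. t b < \<tau>}"
      unfolding ct_def by (simp add: card_Un_le)
    finally show ?thesis .
  qed
  have noties: "t b \<noteq> t b'" if "b \<in> P" "b' \<in> N" for b b'
  proof
    assume eq: "t b = t b'"
    define s where "s = - (x b / x b')"
    have s: "0 < s" using that by (simp add: s_def P_def N_def divide_pos_neg)
    have "x b' \<noteq> 0" "x b \<noteq> 0" using that by (auto simp: P_def N_def)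
    have im: "Im (\<zeta> b) = t b * x b" "Im (\<zeta> b') = t b * x b'"
      using Imt[of b] Imt[of b'] that eq by (auto simp: P_def N_def)
    have "\<zeta> b + of_real s * \<zeta> b' = 0"
      using \<open>x b' \<noteq> 0\<close> im by (simp add: complex_eq_iff s_def flip: x_def)
    then have "w * (z b + of_real s * z b') = 0" by (simp add: \<zeta>_def algebra_simps)
    then show False using \<open>w \<noteq> 0\<close> opp[of b b' s] s that by (simp add: P_def N_def)
  qed
  have generic: "\<exists>\<tau>. \<tau> \<notin> T \<and> a < \<tau> \<and> \<tau> < b" if "a < b" for a b
  proof -
    have "infinite {a<..<b}" using that by simp
    then have "\<not> {a<..<b} \<subseteq> T" using T finite_subset by blast
    then show ?thesis by auto
  qed
  have "k' \<le> card N"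
  proof -
    obtain a where a: "\<And>b. b \<in> B \<Longrightarrow> a < t b"
    proof -
      have "Min (insert 0 (t ` B)) - 1 < t b" if "b \<in> B" for b
      proof -
        have "Min (insert 0 (t ` B)) \<le> t b" using B that by (intro Min_le) auto
        then show ?thesis by linarith
      qed
      then show ?thesis by (rule that)
    qed
    obtain \<tau> where \<tau>: "\<tau> \<notin> T" "\<tau> < a" using generic[of "a - 1" a] by auto
    then have emp: "{b \<in> P. t b < \<tau>} = {}" using a by (force simp: P_def)
    have "k' \<le> card {b \<in> N. \<tau> < t b}" using below[OF \<tau>(1)] unfolding emp by simp
    also have "\<dots> \<le> card N" using fin by (intro card_mono) auto
    finally show ?thesis .
  qed
  then obtain e where e: "card N = k' + e" using le_Suc_ex by blast
  obtain f where f: "bij_betw f {..<k'} P" "\<And>i j. i \<le> j \<Longrightarrow> j < k' \<Longrightarrow> t (f i) \<le> t (f j)"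
    using sorted_enumeration[OF fin(1), of t, folded k'_def] by blast
  obtain g where g: "bij_betw g {..<k' + e} N" "\<And>i j. i \<le> j \<Longrightarrow> j < k' + e \<Longrightarrow> t (g i) \<le> t (g j)"
    using sorted_enumeration[OF fin(2), of t, unfolded e] by blast
  have fP: "f i \<in> P" if "i < k'" for i using f(1) that by (auto dest: bij_betwE)
  have gN: "g i \<in> N" if "i < k' + e" for i using g(1) that by (auto dest: bij_betwE)
  have fsur: "\<exists>i<k'. b = f i" if "b \<in> P" for b
    using f(1) that by (auto simp: bij_betw_def)
  have gsur: "\<exists>i<k' + e. b = g i" if "b \<in> N" for b
    using g(1) that by (auto simp: bij_betw_def)
  have lower: "t (g i) < t (f i)" if i: "i < k'" for i
  proof (rule ccontr)
    assume "\<not> t (g i) < t (f i)"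
    then have "t (f i) < t (g i)" using noties[OF fP gN, of i i] i by simp
    then obtain \<tau> where \<tau>: "\<tau> \<notin> T" "t (f i) < \<tau>" "\<tau> < t (g i)" using generic by blast
    have "{b \<in> P. \<tau> < t b} \<subseteq> f ` {Suc i..<k'}"
    proof
      fix b assume b: "b \<in> {b \<in> P. \<tau> < t b}"
      then obtain j where j: "j < k'" "b = f j" using fsur by blast
      have "\<not> j \<le> i" using f(2)[of j i] b j \<tau> i by auto
      then show "b \<in> f ` {Suc i..<k'}" using j by auto
    qed
    then have "card {b \<in> P. \<tau> < t b} \<le> card {Suc i..<k'}"
      by (rule surj_card_le[rotated]) simp
    moreover have "{b \<in> N. t b < \<tau>} \<subseteq> g ` {..<i}"
    proof
      fix b assume b: "b \<in> {b \<in> N. t b < \<tau>}"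
      then obtain j where j: "j < k' + e" "b = g j" using gsur by blast
      have "\<not> i \<le> j" using g(2)[of i j] b j \<tau> by auto
      then show "b \<in> g ` {..<i}" using j by auto
    qed
    then have "card {b \<in> N. t b < \<tau>} \<le> card {..<i}"
      by (rule surj_card_le[rotated]) simp
    ultimately show False using above[OF \<tau>(1)] i by simp
  qed
  have upper: "t (f i) < t (g (i + e))" if i: "i < k'" for i
  proof (rule ccontr)
    assume "\<not> t (f i) < t (g (i + e))"
    then have "t (g (i + e)) < t (f i)" using noties[OF fP gN, of i "i + e"] i by simp
    then obtain \<tau> where \<tau>: "\<tau> \<notin> T" "t (g (i + e)) < \<tau>" "\<tau> < t (f i)" using generic by blast
    have "{b \<in> P. t b < \<tau>} \<subseteq> f ` {..<i}"
    proof
      fix b assume b: "b \<in> {b \<in> P. t b < \<tau>}"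
      then obtain j where j: "j < k'" "b = f j" using fsur by blast
      have "\<not> i \<le> j" using f(2)[of i j] b j \<tau> by auto
      then show "b \<in> f ` {..<i}" using j by auto
    qed
    then have "card {b \<in> P. t b < \<tau>} \<le> card {..<i}"
      by (rule surj_card_le[rotated]) simp
    moreover have "{b \<in> N. \<tau> < t b} \<subseteq> g ` {Suc (i + e)..<k' + e}"
    proof
      fix b assume b: "b \<in> {b \<in> N. \<tau> < t b}"
      then obtain j where j: "j < k' + e" "b = g j" using gsur by blast
      have "\<not> j \<le> i + e" using g(2)[of j "i + e"] b j \<tau> i by auto
      then show "b \<in> g ` {Suc (i + e)..<k' + e}" using j by auto
    qed
    then have "card {b \<in> N. \<tau> < t b} \<le> card {Suc (i + e)..<k' + e}"
      by (rule surj_card_le[rotated]) simp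
    ultimately show False using below[OF \<tau>(1)] i by simp
  qed
  show ?thesis
  proof (rule that[OF normw, of k' f g e])
    show "k \<le> k'" using kct[OF w] k' by simp
    show "bij_betw f {..<k'} {b \<in> B. 0 < Re (w * z b)}" using f(1) by (simp add: P_def x_def \<zeta>_def)
    show "bij_betw g {..<k' + e} {b \<in> B. Re (w * z b) < 0}" using g(1) by (simp add: N_def x_def \<zeta>_def)
    show "Re (w * z b) \<noteq> 0" if "b \<in> B" for b using nz[OF w that] .
    show "Im (w * z (g i)) / Re (w * z (g i)) < Im (w * z (f i)) / Re (w * z (f i)) \<and>
       Im (w * z (f i)) / Re (w * z (f i)) < Im (w * z (g (i + e))) / Re (w * z (g (i + e)))"
      if "i < k'" for i using lower[OF that] upper[OF that] by (simp add: t_def \<zeta>_def)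
  qed
qed

lemma Re_of_real_mult: "Re (of_real a * z) = a * Re z" "Re (z * of_real a) = Re z * a"
  by simp_all

section \<open>Diagonal forms\<close>

lemma form_diagonal:
  assumes "finite B" "\<And>x y. x \<in> B \<Longrightarrow> y \<in> B \<Longrightarrow> x \<noteq> y \<Longrightarrow> cinner_vec (A *v x) y = 0"
  shows "cinner_vec (A *v (\<Sum>b\<in>B. c b *s b)) (\<Sum>b\<in>B. d b *s b)
    = (\<Sum>b\<in>B. c b * cnj (d b) * cinner_vec (A *v b) b)"
proof -
  have "cinner_vec (A *v (\<Sum>b\<in>B. c b *s b)) (\<Sum>b\<in>B. d b *s b) =
      (\<Sum>b\<in>B. \<Sum>b'\<in>B. c b * cnj (d b') * cinner_vec (A *v b) b')"
    by (simp add: vec.linear_sum[OF matrix_vector_mul_linear_gen] vector_scalar_commute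
        cinner_sum_left cinner_sum_right cinner_scale_left cinner_scale_right sum_distrib_left mult_ac)
      (rule sum.swap)
  also have "\<dots> = (\<Sum>b\<in>B. \<Sum>b'\<in>B. if b' = b then c b * cnj (d b) * cinner_vec (A *v b) b else 0)"
    using assms(2) by (intro sum.cong) auto
  also have "\<dots> = (\<Sum>b\<in>B. c b * cnj (d b) * cinner_vec (A *v b) b)"
    using assms(1) by simp
  finally show ?thesis .
qed

lemma scalar_on_0_span:
  assumes "\<And>x y. x \<in> S \<Longrightarrow> y \<in> S \<Longrightarrow> cinner_vec (A *v x) y = 0"
  shows "scalar_on A 0 (vec.span S)"
proof -
  have 1: "cinner_vec (A *v x) y = 0" if "x \<in> S" "y \<in> vec.span S" for x y
    using cinner_span_right[OF that(2)] assms[OF that(1)] by blast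
  have "cinner_vec (A *v x) y = 0" if x: "x \<in> vec.span S" and y: "y \<in> vec.span S" for x y
  proof -
    have "cinner_vec (conj_transpose A *v y) x = 0"
      using x by (rule cinner_span_right) (simp add: cinner_adjoint_left 1[OF _ y])
    then show ?thesis by (simp add: cinner_adjoint_left)
  qed
  then show ?thesis by (simp add: scalar_on_def)
qed

lemma dim_span_family:
  fixes v :: "nat \<Rightarrow> complex^'n"
  assumes "\<And>a i. (\<Sum>i<k. a i *s v i) = 0 \<Longrightarrow> i < k \<Longrightarrow> a i = 0"
  shows "vec.dim (vec.span (v ` {..<k})) = k"
proof -
  have inj: "inj_on v {..<k}"
  proof (rule inj_onI, rule ccontr)
    fix i j assume ij: "i \<in> {..<k}" "j \<in> {..<k}" "v i = v j" "i \<noteq> j"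
    let ?a = "\<lambda>l. (if l = i then 1 else 0) - (if l = j then 1 else 0) :: complex"
    have "(\<Sum>l<k. ?a l *s v l) = (\<Sum>l<k. (if l = i then v i else 0) - (if l = j then v j else 0))"
      by (rule sum.cong) auto
    also have "\<dots> = 0" using ij by (simp add: sum_subtractf)
    finally have "?a i = 0" using ij(1) by (intro assms) auto
    then show False using ij(4) by simp
  qed
  have "vec.independent (v ` {..<k})"
  proof
    assume "vec.dependent (v ` {..<k})"
    then obtain u where u: "\<exists>x\<in>v ` {..<k}. u x \<noteq> 0" "(\<Sum>x\<in>v ` {..<k}. u x *s x) = 0"
      using vec.dependent_finite[of "v ` {..<k}"] by auto
    have "(\<Sum>i<k. u (v i) *s v i) = 0" using u(2) inj by (simp add: sum.reindex)
    then show False using u(1) assms[of "\<lambda>i. u (v i)"] by auto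
  qed
  then show ?thesis using vec.dim_eq_card_independent[of "v ` {..<k}"] inj by (simp add: card_image)
qed

lemma span_coefficients:
  assumes "finite B" "v \<in> vec.span B"
  obtains c where "v = (\<Sum>b\<in>B. c b *s b)"
  using assms vec.span_finite[OF assms(1)] by auto

lemma independent_coefficients:
  assumes "vec.independent B" "finite B" "(\<Sum>b\<in>B. c b *s b) = 0" "b \<in> B"
  shows "c b = 0"
  using vec.dependent_finite[OF assms(2)] assms by auto

text \<open>Scale the basis so that, after rotation by \<open>w\<close>, the values of the form are
  \<open>1 + \<i> t\<close> on the basis vectors with value in the right half-plane and \<open>- (1 +
  \<i> t)\<close> on the others, where \<open>t\<close> is the slope. On the graph of a map from the
  coordinates of the former to those of the latter the form vanishes if and only if the map is an
  isometry and compresses the second diagonal matrix of slopes to the first one. The interlacing of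
  slopes provides such a map, and the graph has dimension \<open>k' \<ge> k\<close>.\<close>
lemma diagonal_isotropic:
  fixes A :: "complex^'n^'n"
  assumes B: "vec.independent B"
    and diag: "\<And>x y. x \<in> B \<Longrightarrow> y \<in> B \<Longrightarrow> x \<noteq> y \<Longrightarrow> cinner_vec (A *v x) y = 0"
    and z0: "\<And>b. b \<in> B \<Longrightarrow> cinner_vec (A *v b) b \<noteq> 0"
    and opp: "\<And>b b' s. b \<in> B \<Longrightarrow> b' \<in> B \<Longrightarrow> 0 < s \<Longrightarrow>
      cinner_vec (A *v b) b + of_real s * cinner_vec (A *v b') b' \<noteq> 0"
    and F: "finite F"
    and count: "\<And>w. norm w = 1 \<Longrightarrow> w \<notin> F \<Longrightarrow> k \<le> card {b \<in> B. 0 \<le> Re (w * cinner_vec (A *v b) b)}"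
  obtains V where "vec.subspace V" "V \<subseteq> vec.span B" "vec.dim V = k" "scalar_on A 0 V"
proof -
  have fin: "finite B" using B by (rule vec.finiteI_independent)
  define z where "z b = cinner_vec (A *v b) b" for b
  obtain w k' e f g where w: "norm w = 1" "k \<le> k'"
    and f: "bij_betw f {..<k'} {b \<in> B. 0 < Re (w * z b)}"
    and g: "bij_betw g {..<k' + e} {b \<in> B. Re (w * z b) < 0}"
    and nz: "\<And>b. b \<in> B \<Longrightarrow> Re (w * z b) \<noteq> 0"
    and int: "\<And>i. i < k' \<Longrightarrow> Im (w * z (g i)) / Re (w * z (g i)) < Im (w * z (f i)) / Re (w * z (f i)) \<and>
       Im (w * z (f i)) / Re (w * z (f i)) < Im (w * z (g (i + e))) / Re (w * z (g (i + e)))"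
    by (rule circle_configuration[OF fin z0 opp F count, folded z_def]) auto
  show ?thesis
  proof (cases "k' = 0")
    case True
    then show ?thesis using that[of "{0}"] w(2) vec.span_zero[of B] by (auto simp: scalar_on_def)
  next
    case False
    have e: "0 < e"
    proof (rule ccontr)
      assume "\<not> 0 < e"
      then show False using int[of 0] False by simp
    qed
    define x where "x b = Re (w * z b)" for b
    define t where "t b = Im (w * z b) / x b" for b
    define P where "P = {b \<in> B. 0 < x b}"
    define N where "N = {b \<in> B. x b < 0}"
    have BPN: "B = P \<union> N" "P \<inter> N = {}" "finite P" "finite N"
      using nz fin by (auto simp: P_def N_def x_def) force
    have f: "bij_betw f {..<k'} P" and g: "bij_betw g {..<k' + e} N"
      using f g by (simp_all add: P_def N_def x_def)
    have wz: "w * z b = of_real (x b) * (1 + \<i> * of_real (t b))" if "b \<in> B" for b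
      using nz[OF that] unfolding x_def[symmetric]
      by (simp add: complex_eq_iff t_def) (simp add: x_def)
    obtain y where y: "\<And>i i'. i < k' \<Longrightarrow> i' < k' \<Longrightarrow> (\<Sum>j<k'+e. y i j * y i' j) = (if i = i' then 1 else 0)"
      "\<And>i i'. i < k' \<Longrightarrow> i' < k' \<Longrightarrow>
         (\<Sum>j<k'+e. t (g j) * (y i j * y i' j)) = (if i = i' then t (f i) else (0::real))"
      using interlacing_compression[of e k' "\<lambda>j. t (g j)" "\<lambda>i. t (f i)", OF e] int
      unfolding t_def x_def by blast
    define g' where "g' = the_inv_into {..<k' + e} g"
    have g': "g' (g j) = j" if "j < k' + e" for j
      using the_inv_into_f_f[of g "{..<k' + e}" j] g that by (simp add: g'_def bij_betw_def)
    define c where "c i b = (if b \<in> P then (if b = f i then 1 / sqrt (x b) else 0)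
       else y i (g' b) / sqrt (- x b))" for i b
    define v where "v i = (\<Sum>b\<in>B. complex_of_real (c i b) *s b)" for i
    have fP: "f i \<in> P" if "i < k'" for i using f that by (auto dest: bij_betwE)
    have gN: "g j \<in> N" if "j < k' + e" for j using g that by (auto dest: bij_betwE)
    have finj: "f i = f i' \<longleftrightarrow> i = i'" if "i < k'" "i' < k'" for i i'
      using f that by (auto simp: bij_betw_def inj_on_def)
    have iso: "cinner_vec (A *v v i) (v i') = 0" if i: "i < k'" "i' < k'" for i i'
    proof -
      have "w * cinner_vec (A *v v i) (v i') = w * (\<Sum>b\<in>B. of_real (c i b) * cnj (of_real (c i' b)) * z b)"
        unfolding v_def z_def using form_diagonal[OF fin diag] by simp
      also have "\<dots> = (\<Sum>b\<in>B. of_real (c i b * c i' b) * (w * z b))"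
        by (simp add: sum_distrib_left mult_ac)
      also have "\<dots> = (\<Sum>b\<in>B. of_real (c i b * c i' b * x b) * (1 + \<i> * of_real (t b)))"
        by (rule sum.cong) (simp_all add: wz)
      also have "\<dots> = (\<Sum>b\<in>P. of_real (c i b * c i' b * x b) * (1 + \<i> * of_real (t b)))
        + (\<Sum>b\<in>N. of_real (c i b * c i' b * x b) * (1 + \<i> * of_real (t b)))"
        using BPN by (metis (no_types, lifting) sum.union_disjoint)
      also have "(\<Sum>b\<in>P. of_real (c i b * c i' b * x b) * (1 + \<i> * of_real (t b))) =
         (\<Sum>b\<in>P. if b = f i then (if i = i' then 1 + \<i> * of_real (t (f i)) else 0) else 0)"
      proof (rule sum.cong)
        fix b assume "b \<in> P"
        then have "0 < x b" by (simp add: P_def)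
        have "c i b * c i' b * x b = (if b = f i then (if i = i' then 1 else 0) else 0)"
          using \<open>b \<in> P\<close> \<open>0 < x b\<close> finj[OF i] by (auto simp: c_def)
        then show "of_real (c i b * c i' b * x b) * (1 + \<i> * of_real (t b)) =
          (if b = f i then (if i = i' then 1 + \<i> * of_real (t (f i)) else 0) else 0)" by simp
      qed simp
      also have "\<dots> = (if i = i' then 1 + \<i> * of_real (t (f i)) else 0)"
        using BPN(3) fP[OF i(1)] by simp
      also have "(\<Sum>b\<in>N. of_real (c i b * c i' b * x b) * (1 + \<i> * of_real (t b))) =
         (\<Sum>j<k'+e. of_real (c i (g j) * c i' (g j) * x (g j)) * (1 + \<i> * of_real (t (g j))))"
        by (rule sum.reindex_bij_betw[OF g, symmetric])
      also have "\<dots> = (\<Sum>j<k'+e. - complex_of_real (y i j * y i' j) - \<i> * of_real (t (g j) * (y i j * y i' j)))"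
      proof (rule sum.cong)
        fix j assume "j \<in> {..<k'+e}"
        then have j: "j < k' + e" by simp
        have "x (g j) < 0" "g j \<notin> P" using gN[OF j] by (auto simp: N_def P_def)
        then have "c i (g j) * c i' (g j) * x (g j) = - (y i j * y i' j)"
          by (simp add: c_def g'[OF j])
        then show "of_real (c i (g j) * c i' (g j) * x (g j)) * (1 + \<i> * of_real (t (g j))) =
            - complex_of_real (y i j * y i' j) - \<i> * of_real (t (g j) * (y i j * y i' j))"
          by (simp add: algebra_simps)
      qed simp
      also have "\<dots> = - complex_of_real (\<Sum>j<k'+e. y i j * y i' j)
          - \<i> * complex_of_real (\<Sum>j<k'+e. t (g j) * (y i j * y i' j))"
        by (simp add: sum_subtractf sum_negf sum_distrib_left)
      also have "\<dots> = - (if i = i' then 1 + \<i> * of_real (t (f i)) else 0)"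
        using y[OF i] by simp
      finally have "w * cinner_vec (A *v v i) (v i') = 0" by simp
      then show ?thesis using w(1) by auto
    qed
    have indep: "a i = 0" if a: "(\<Sum>i<k'. a i *s v i) = 0" and i: "i < k'" for a i
    proof -
      have "(\<Sum>i<k'. a i *s v i) = (\<Sum>b\<in>B. (\<Sum>i<k'. a i * of_real (c i b)) *s b)"
        unfolding v_def
        by (simp add: vec.scale_sum_right vec.scale_sum_left) (rule sum.swap)
      then have "(\<Sum>l<k'. a l * of_real (c l (f i))) = 0"
        using independent_coefficients[OF B fin, of "\<lambda>b. \<Sum>l<k'. a l * of_real (c l b)" "f i"]
          a fP[OF i] by (simp add: P_def)
      also have "(\<Sum>l<k'. a l * of_real (c l (f i))) =
        (\<Sum>l<k'. if l = i then a i / of_real (sqrt (x (f i))) else 0)"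
        by (rule sum.cong) (use fP[OF i] finj[OF i] in \<open>auto simp: c_def\<close>)
      finally show ?thesis using i fP[OF i] by (auto simp: P_def)
    qed
    let ?V = "vec.span (v ` {..<k'})"
    have "vec.dim ?V = k'" using indep by (rule dim_span_family)
    then obtain V where V: "vec.subspace V" "V \<subseteq> ?V" "vec.dim V = k"
      using subspace_of_dim[OF vec.subspace_span, of k "v ` {..<k'}"] w(2) by auto
    have "scalar_on A 0 ?V" using iso by (intro scalar_on_0_span) auto
    then have "scalar_on A 0 V" using V(2) scalar_on_subset by blast
    moreover have "v i \<in> vec.span B" for i
      unfolding v_def by (intro vec.span_sum vec.span_scale vec.span_base)
    then have "?V \<subseteq> vec.span B" by (intro vec.span_minimal vec.subspace_span) auto
    ultimately show ?thesis using that V by blast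
  qed
qed

text \<open>Basis vectors with opposite values have proportional values of the form and its adjoint, so
  every combination of them is an eigenvector of the pencil, and one combination is isotropic. This is
  why opposite values need not be considered in the diagonal case.\<close>
lemma isotropic_eigenvector_of_opposite:
  fixes A :: "complex^'n^'n"
  assumes B: "vec.independent B" "vec.span B = U"
    and diag: "\<And>x y. x \<in> B \<Longrightarrow> y \<in> B \<Longrightarrow> x \<noteq> y \<Longrightarrow> cinner_vec (A *v x) y = 0"
    and b: "b \<in> B" "b' \<in> B" and s: "0 < s"
    and opp: "cinner_vec (A *v b) b + of_real s * cinner_vec (A *v b') b' = 0"
    and z0: "cinner_vec (A *v b) b \<noteq> 0"
  shows "\<exists>x. isotropic_eigenvector A U x"
proof -
  define z where "z b = cinner_vec (A *v b) b" for b
  define r where "r = complex_of_real (sqrt s)"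
  have rr: "r * r = of_real s" "cnj r = r" using s by (simp_all add: r_def flip: of_real_mult)
  have ne: "b \<noteq> b'"
  proof
    assume "b = b'"
    then have "of_real (1 + s) * z b = 0" using opp by (simp add: z_def algebra_simps)
    then have "1 + s = 0" using z0 unfolding z_def mult_eq_0_iff of_real_eq_0_iff by blast
    then show False using s by simp
  qed
  define x where "x = b + r *s b'"
  have opp': "z b = - of_real s * z b'" using opp by (simp add: z_def eq_neg_iff_add_eq_0)
  have cross: "cinner_vec (A *v b) b' = 0" "cinner_vec (A *v b') b = 0"
    using diag b ne by blast+
  have "cinner_vec (A *v x) x = 0"
    unfolding x_def form_add_scaled using cross opp by (simp add: rr)
  moreover have "x \<noteq> 0"
  proof
    assume "x = 0"
    then have "b = (- r) *s b'" by (simp add: x_def eq_neg_iff_add_eq_0)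
    moreover have "b' \<in> vec.span (B - {b})" using b ne by (simp add: vec.span_base)
    ultimately have "b \<in> vec.span (B - {b})" by (metis vec.span_scale)
    then show False using B(1) b(1) by (auto simp: vec.dependent_def)
  qed
  moreover have "x \<in> U" unfolding x_def B(2)[symmetric] using b
    by (intro vec.span_add vec.span_scale vec.span_base)
  moreover have "cnj (z b) * cinner_vec (A *v x) u = z b * cinner_vec (conj_transpose A *v x) u"
    if "u \<in> U" for u
  proof -
    have "cinner_vec (cnj (z b) *s (A *v x) - z b *s (conj_transpose A *v x)) u = 0"
    proof (rule cinner_span_right)
      show "u \<in> vec.span B" using that B(2) by simp
      fix y assume y: "y \<in> B"
      have Ax: "cinner_vec (A *v x) y = cinner_vec (A *v b) y + r * cinner_vec (A *v b') y"
        by (simp add: x_def matrix_vector_right_distrib vector_scalar_commute cinner_simps)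
      have Ax': "cinner_vec (conj_transpose A *v x) y = cnj (cinner_vec (A *v y) b + r * cinner_vec (A *v y) b')"
        by (simp add: cinner_adjoint_left x_def cinner_simps rr)
      consider "y = b" | "y = b'" | "y \<noteq> b" "y \<noteq> b'" by blast
      then show "cinner_vec (cnj (z b) *s (A *v x) - z b *s (conj_transpose A *v x)) y = 0"
      proof cases
        case 1
        then show ?thesis
          unfolding cinner_diff_left cinner_scale_left Ax Ax' by (simp add: cross flip: z_def)
      next
        case 2
        then show ?thesis
          unfolding cinner_diff_left cinner_scale_left Ax Ax'
          by (simp add: cross rr opp' flip: z_def)
      next
        case 3
        then have "cinner_vec (A *v b) y = 0" "cinner_vec (A *v b') y = 0"
          "cinner_vec (A *v y) b = 0" "cinner_vec (A *v y) b' = 0"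
          using diag[OF b(1) y] diag[OF b(2) y] diag[OF y b(1)] diag[OF y b(2)] by auto
        then show ?thesis unfolding cinner_diff_left cinner_scale_left Ax Ax' by simp
      qed
    qed
    then show ?thesis by (simp only: cinner_diff_left cinner_scale_left right_minus_eq)
  qed
  ultimately have "isotropic_eigenvector A U x"
    unfolding isotropic_eigenvector_def using z0 by (metis z_def complex_cnj_zero_iff)
  then show ?thesis ..
qed

section \<open>Existence of isotropic subspaces\<close>

text \<open>The theorem of Li and Sze in homogeneous form. The two cases of the induction step are the
  splitting off of an isotropic eigenvector and the diagonal case. In the latter, the number of basis
  vectors in each half-plane is bounded below because a subspace on which the Hermitian part is
  nonnegative meets the span of the basis vectors with negative values only in zero.\<close>
theorem isotropic_subspace_exists:
  fixes A :: "complex^'n^'n"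
  assumes "vec.subspace U" "generically_nonneg A U k"
  shows "\<exists>V. vec.subspace V \<and> V \<subseteq> U \<and> vec.dim V = k \<and> scalar_on A 0 V"
  using assms
proof (induction "vec.dim U" arbitrary: U k rule: less_induct)
  case less
  note U = \<open>vec.subspace U\<close> and pos = \<open>generically_nonneg A U k\<close>
  have spanU: "vec.span U = U" using U vec.span_eq_iff by blast
  show ?case
  proof (cases "k = 0")
    case True
    then show ?thesis using vec.subspace_0[OF U]
      by (intro exI[of _ "{0}"]) (auto simp: scalar_on_def)
  next
    case k0: False
    show ?thesis
    proof (cases "\<exists>x. isotropic_eigenvector A U x")
      case True
      then obtain x where x: "isotropic_eigenvector A U x" ..
      then have xU: "x \<in> U" "cinner_vec (A *v x) x = 0" by (auto simp: isotropic_eigenvector_def)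
      obtain U' where U': "vec.subspace U'" "U' \<subseteq> U" "x \<notin> U'"
        "\<And>u. u \<in> U' \<Longrightarrow> cinner_vec (A *v x) u = 0 \<and> cinner_vec (A *v u) x = 0"
        "generically_nonneg A U' (k - 1)"
        using isotropic_eigenvector_reduction[OF U x pos] by blast
      have "vec.dim U' < vec.dim U"
      proof (rule vec.dim_psubset)
        have "vec.span U' = U'" using U'(1) vec.span_eq_iff by blast
        then show "vec.span U' \<subset> vec.span U" using U'(2,3) xU spanU by blast
      qed
      from less.hyps[OF this U'(1,5)] obtain V where V: "vec.subspace V" "V \<subseteq> U'"
        "vec.dim V = k - 1" "scalar_on A 0 V" by blast
      have "vec.span V = V" using V(1) vec.span_eq_iff by blast
      then have "x \<notin> vec.span V" using V(2) U'(3) by blast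
      then have "vec.dim (vec.span (insert x V)) = k" using V(3) k0 by (simp add: vec.dim_insert)
      moreover have "scalar_on A 0 (vec.span (insert x V))"
      proof (rule scalar_on_0_span)
        fix a b assume "a \<in> insert x V" "b \<in> insert x V"
        then show "cinner_vec (A *v a) b = 0"
          using U'(4) V(2,4) xU(2) by (auto simp: scalar_on_def subset_iff)
      qed
      moreover have "vec.span (insert x V) \<subseteq> U"
        using xU(1) V(2) U'(2) U by (intro vec.span_minimal) auto
      ultimately show ?thesis using vec.subspace_span by blast
    next
      case False
      then obtain B where B: "vec.independent B" "vec.span B = U"
        and diag: "\<And>x y. x \<in> B \<Longrightarrow> y \<in> B \<Longrightarrow> x \<noteq> y \<Longrightarrow> cinner_vec (A *v x) y = 0"
        using diagonalising_basis[OF U, of A] by blast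
      have fin: "finite B" using B(1) by (rule vec.finiteI_independent)
      have z0: "cinner_vec (A *v b) b \<noteq> 0" if b: "b \<in> B" for b
      proof
        assume 0: "cinner_vec (A *v b) b = 0"
        have "cinner_vec (A *v b) u = 0" if "u \<in> U" for u
          using that unfolding B(2)[symmetric] by (rule cinner_span_right) (use 0 diag b in metis)
        moreover have "b \<noteq> 0" using B(1) b vec.dependent_zero by blast
        moreover have "b \<in> U" using B(2) b vec.span_base by blast
        ultimately have "isotropic_eigenvector A U b"
          unfolding isotropic_eigenvector_def by (intro conjI exI[of _ 1] exI[of _ 0]) auto
        then show False using False by blast
      qed
      have opp: "cinner_vec (A *v b) b + of_real s * cinner_vec (A *v b') b' \<noteq> 0"
        if "b \<in> B" "b' \<in> B" "0 < s" for b b' s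
        using isotropic_eigenvector_of_opposite[OF B diag that _ z0[OF that(1)]] False by blast
      obtain F where F: "finite F" "\<And>w. norm w = 1 \<Longrightarrow> w \<notin> F \<Longrightarrow>
         \<exists>V. vec.subspace V \<and> V \<subseteq> U \<and> k \<le> vec.dim V \<and> nonneg_on w A V"
        using pos by (auto simp: generically_nonneg_def)
      have count: "k \<le> card {b \<in> B. 0 \<le> Re (w * cinner_vec (A *v b) b)}"
        if w: "norm w = 1" "w \<notin> F" for w
      proof -
        obtain V where V: "vec.subspace V" "V \<subseteq> U" "k \<le> vec.dim V" "nonneg_on w A V"
          using F(2)[OF w] by blast
        define N where "N = {b \<in> B. Re (w * cinner_vec (A *v b) b) < 0}"
        have NB: "N \<subseteq> B" "finite N" using fin by (auto simp: N_def)
        have "V \<inter> vec.span N \<subseteq> {0}"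
        proof
          fix v assume v: "v \<in> V \<inter> vec.span N"
          obtain c where c: "v = (\<Sum>b\<in>N. c b *s b)"
            using span_coefficients[OF NB(2)] v by blast
          have "cinner_vec (A *v v) v = (\<Sum>b\<in>N. c b * cnj (c b) * cinner_vec (A *v b) b)"
            unfolding c using diag NB by (intro form_diagonal) auto
          then have "w * cinner_vec (A *v v) v =
            (\<Sum>b\<in>N. of_real ((norm (c b))\<^sup>2) * (w * cinner_vec (A *v b) b))"
            unfolding complex_norm_square by (simp add: sum_distrib_left mult_ac)
          then have eq: "Re (w * cinner_vec (A *v v) v) =
            (\<Sum>b\<in>N. (norm (c b))\<^sup>2 * Re (w * cinner_vec (A *v b) b))"
            by (simp only: Re_sum Re_of_real_mult)
          have "c b = 0" if "b \<in> N" for b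
          proof (rule ccontr)
            assume "c b \<noteq> 0"
            have "(\<Sum>b\<in>N. (norm (c b))\<^sup>2 * Re (w * cinner_vec (A *v b) b)) < (\<Sum>b\<in>N. 0)"
              using that \<open>c b \<noteq> 0\<close> NB(2)
              by (intro sum_strict_mono_ex1 ballI bexI[of _ b])
                (auto simp: N_def mult_less_0_iff intro!: mult_nonneg_nonpos)
            then show False using V(4) v eq by (force simp: nonneg_on_def)
          qed
          then show "v \<in> {0}" by (simp add: c)
        qed
        then have "vec.dim (V \<inter> vec.span N) = 0" by simp
        moreover have "vec.dim {x + y |x y. x \<in> V \<and> y \<in> vec.span N} \<le> vec.dim U"
        proof (rule vec.dim_subset)
          have "vec.span N \<subseteq> U" using NB(1) B(2) vec.span_mono by blast
          then show "{x + y |x y. x \<in> V \<and> y \<in> vec.span N} \<subseteq> U"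
            using V(2) U by (auto intro!: vec.subspace_add)
        qed
        moreover have "vec.dim (vec.span N) = card N"
          using B(1) NB(1) vec.independent_mono vec.dim_span_eq_card_independent by blast
        moreover have "vec.dim U = card B"
          using B vec.dim_span_eq_card_independent by blast
        ultimately have "k + card N \<le> card B"
          using vec.dim_sums_Int[OF V(1) vec.subspace_span, of N] V(3) by linarith
        moreover have "{b \<in> B. 0 \<le> Re (w * cinner_vec (A *v b) b)} = B - N" by (auto simp: N_def)
        ultimately show ?thesis using NB by (simp add: card_Diff_subset)
      qed
      show ?thesis
        using diagonal_isotropic[OF B(1) diag z0 opp F(1) count] B(2) by blast
    qed
  qed
qed

section \<open>From numerical ranges to nonnegative subspaces\<close>

lemma form_bound:
  fixes A :: "complex^'n^'n"
  assumes "norm w = 1"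
  shows "\<bar>Re (w * cinner_vec (A *v v) v)\<bar> \<le> opnorm A * (norm v)\<^sup>2"
proof -
  have "complex_of_real ((norm (w *s (A *v v)))\<^sup>2) = (w * cnj w) * complex_of_real ((norm (A *v v))\<^sup>2)"
    unfolding cinner_self[symmetric] by (simp add: cinner_simps)
  also have "w * cnj w = 1" using assms complex_norm_square[of w] by simp
  finally have "norm (w *s (A *v v)) = norm (A *v v)"
    unfolding mult_1_left of_real_eq_iff by simp
  moreover have "norm (A *v v) \<le> opnorm A * norm v"
    unfolding opnorm_def by (rule onorm) simp
  moreover have "Re (w * cinner_vec (A *v v) v) = (w *s (A *v v)) \<bullet> v"
    by (simp add: cinner_simps flip: Re_cinner)
  ultimately have "\<bar>Re (w * cinner_vec (A *v v) v)\<bar> \<le> norm (A *v v) * norm v"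
    using Cauchy_Schwarz_ineq2[of "w *s (A *v v)" v] by simp
  also have "\<dots> \<le> opnorm A * norm v * norm v"
    using \<open>norm (A *v v) \<le> _\<close> by (intro mult_right_mono) auto
  finally show ?thesis by (simp add: power2_eq_square mult.assoc)
qed

text \<open>The spectral theorem for the Hermitian matrix \<open>A + A\<^sup>*\<close> is the diagonal
  case for the matrix \<open>A + A\<^sup>* + \<i> I\<close>: the imaginary part of its form is the
  squared norm, so it has no isotropic vectors, and a basis that is orthogonal for this form is
  orthogonal for its real and imaginary parts.\<close>
lemma hermitian_diagonalisation:
  fixes A :: "complex^'n^'n"
  obtains B where "vec.independent B" "vec.span B = UNIV"
    "\<And>x y. x \<in> B \<Longrightarrow> y \<in> B \<Longrightarrow> x \<noteq> y \<Longrightarrow> cinner_vec x y = 0"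
    "\<And>x y. x \<in> B \<Longrightarrow> y \<in> B \<Longrightarrow> x \<noteq> y \<Longrightarrow> cinner_vec (A *v x) y + cinner_vec (conj_transpose A *v x) y = 0"
proof -
  define M where "M = A + conj_transpose A + scale_matrix \<i> (mat 1)"
  have M: "cinner_vec (M *v x) y =
     (cinner_vec (A *v x) y + cinner_vec (conj_transpose A *v x) y) + \<i> * cinner_vec x y" for x y
    by (simp add: M_def matrix_vector_mult_add_rdistrib scale_matrix_vec cinner_simps)
  have "\<not> isotropic_eigenvector M UNIV x" for x
  proof
    assume "isotropic_eigenvector M UNIV x"
    then have "x \<noteq> 0" "cinner_vec (M *v x) x = 0" by (auto simp: isotropic_eigenvector_def)
    moreover have "Im (cinner_vec (M *v x) x) = (norm x)\<^sup>2"
      unfolding M by (simp add: cinner_adjoint_left cinner_self)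
    ultimately show False by simp
  qed
  then obtain B where B: "vec.independent B" "vec.span B = UNIV"
    and diag: "\<And>x y. x \<in> B \<Longrightarrow> y \<in> B \<Longrightarrow> x \<noteq> y \<Longrightarrow> cinner_vec (M *v x) y = 0"
    using diagonalising_basis[OF vec.subspace_UNIV, of M] by blast
  have "cinner_vec x y = 0 \<and> cinner_vec (A *v x) y + cinner_vec (conj_transpose A *v x) y = 0"
    if "x \<in> B" "y \<in> B" "x \<noteq> y" for x y
  proof -
    define h where "h = cinner_vec (A *v x) y + cinner_vec (conj_transpose A *v x) y"
    have 1: "h + \<i> * cinner_vec x y = 0" using diag[OF that] by (simp add: M h_def)
    have "cnj (cinner_vec (M *v y) x) = 0" using diag[of y x] that by simp
    then have 2: "h - \<i> * cinner_vec x y = 0"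
      unfolding M by (simp add: cinner_adjoint_left cnj_cinner h_def add.commute)
    have "(h + \<i> * cinner_vec x y) + (h - \<i> * cinner_vec x y) = 2 * h" by simp
    then have "h = 0" unfolding 1 2 by simp
    then show ?thesis using 1 by (simp add: h_def)
  qed
  then show ?thesis using that B by blast
qed

text \<open>Let \<open>q\<close> be the form of the Hermitian part of \<open>w (A - c I)\<close>, and
  \<open>L\<close> the real part of \<open>w c\<close>. If fewer than \<open>k\<close> vectors of an
  orthogonal eigenbasis have \<open>q b \<ge> 0\<close>, enlarge this set of vectors to a set
  \<open>X\<close> of \<open>k - 1\<close> vectors and perturb \<open>A\<close> by the projection onto
  its span, with the phase \<open>\<xi>\<close> for which the perturbation subtracts \<open>2
  \<parallel>A\<parallel>\<close> there. A unit vector \<open>x = u + v\<close> attaining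
  \<open>c\<close>, with \<open>u\<close> in the span of \<open>X\<close>, then satisfies \<open>q x = 2
  \<parallel>A\<parallel> \<parallel>u\<parallel>\<^sup>2\<close>. But \<open>q v\<close> is negative
  unless \<open>v = 0\<close>, and \<open>q u \<le> (\<parallel>A\<parallel> - L)
  \<parallel>u\<parallel>\<^sup>2\<close> where \<open>L > - \<parallel>A\<parallel>\<close>, since some
  basis vector outside \<open>X\<close> has a Rayleigh quotient below \<open>L\<close>. Since \<open>q x
  = q u + q v\<close>, this leaves only \<open>u = v = 0\<close>, and \<open>x\<close> is not a unit
  vector.\<close>
lemma nonneg_subspace_of_num_ranges:
  fixes A :: "complex^'n^'n"
  assumes k: "1 \<le> k" "k \<le> CARD('n)"
    and num: "\<And>\<xi> P. \<xi> \<in> {0..<2 * pi} \<Longrightarrow> P \<in> orth_projections (k - 1) \<Longrightarrow>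
      c \<in> num_range (A + perturbation A \<xi> P)"
    and w: "norm w = 1"
  shows "\<exists>V. vec.subspace V \<and> k \<le> vec.dim V \<and> nonneg_on w (A - scale_matrix c (mat 1)) V"
proof -
  define L where "L = Re (w * c)"
  define q where "q v = Re (w * cinner_vec (A *v v) v) - L * (norm v)\<^sup>2" for v
  have q: "Re (w * cinner_vec ((A - scale_matrix c (mat 1)) *v v) v) = q v" for v
  proof -
    have "w * cinner_vec ((A - scale_matrix c (mat 1)) *v v) v
       = w * cinner_vec (A *v v) v - (w * c) * of_real ((norm v)\<^sup>2)"
      by (simp add: matrix_vector_mult_diff_rdistrib scale_matrix_vec cinner_simps
          right_diff_distrib mult.assoc cinner_self)
    then show ?thesis unfolding q_def L_def by (simp only: minus_complex.sel Re_of_real_mult)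
  qed
  obtain B where B: "vec.independent B" "vec.span B = UNIV"
    and orth: "\<And>x y. x \<in> B \<Longrightarrow> y \<in> B \<Longrightarrow> x \<noteq> y \<Longrightarrow> cinner_vec x y = 0"
    and Horth: "\<And>x y. x \<in> B \<Longrightarrow> y \<in> B \<Longrightarrow> x \<noteq> y \<Longrightarrow>
      cinner_vec (scale_matrix w A *v x) y + cinner_vec (conj_transpose (scale_matrix w A) *v x) y = 0"
    using hermitian_diagonalisation[of "scale_matrix w A"] by blast
  have fin: "finite B" using B(1) by (rule vec.finiteI_independent)
  have cardB: "card B = CARD('n)"
    using B vec.dim_span_eq_card_independent[OF B(1)] by (simp add: card_cart_basis)
  define Q where "Q = scale_matrix w A + conj_transpose (scale_matrix w A) - scale_matrix (of_real (2 * L)) (mat 1)"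
  have Q: "cinner_vec (Q *v x) y = (cinner_vec (scale_matrix w A *v x) y
      + cinner_vec (conj_transpose (scale_matrix w A) *v x) y) - of_real (2 * L) * cinner_vec x y" for x y
    unfolding Q_def matrix_vector_mult_diff_rdistrib matrix_vector_mult_add_rdistrib
      scale_matrix_vec[of "complex_of_real (2 * L)"] matrix_vector_mul_lid cinner_simps ..
  have Qq: "cinner_vec (Q *v v) v = of_real (2 * q v)" for v
  proof -
    have "cinner_vec (Q *v v) v = (w * cinner_vec (A *v v) v + cnj (w * cinner_vec (A *v v) v))
       - of_real (2 * L) * of_real ((norm v)\<^sup>2)"
      unfolding Q cinner_adjoint_left scale_matrix_vec cinner_scale_left cinner_self ..
    also have "\<dots> = of_real (2 * q v)" unfolding complex_add_cnj q_def
      by (simp add: algebra_simps)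
    finally show ?thesis .
  qed
  have Qdiag: "cinner_vec (Q *v x) y = 0" if "x \<in> B" "y \<in> B" "x \<noteq> y" for x y
    unfolding Q orth[OF that] Horth[OF that] by simp
  have qsum: "q (\<Sum>b\<in>S. d b *s b) = (\<Sum>b\<in>S. (norm (d b))\<^sup>2 * q b)" if "S \<subseteq> B" for S d
  proof -
    have "complex_of_real (2 * q (\<Sum>b\<in>S. d b *s b)) = (\<Sum>b\<in>S. d b * cnj (d b) * of_real (2 * q b))"
      unfolding Qq[symmetric] using that fin finite_subset Qdiag
      by (intro form_diagonal) blast+
    also have "\<dots> = complex_of_real (2 * (\<Sum>b\<in>S. (norm (d b))\<^sup>2 * q b))"
      by (simp add: sum_distrib_left mult_ac flip: complex_norm_square)
    finally show ?thesis by (simp only: of_real_eq_iff)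
  qed
  define P0 where "P0 = {b \<in> B. 0 \<le> q b}"
  show ?thesis
  proof (cases "k \<le> card P0")
    case True
    have "P0 \<subseteq> B" by (auto simp: P0_def)
    with B(1) have "vec.independent P0" by (rule vec.independent_mono)
    then have "k \<le> vec.dim (vec.span P0)"
      using True vec.dim_span_eq_card_independent by metis
    moreover have "0 \<le> q v" if v: "v \<in> vec.span P0" for v
    proof -
      obtain d where "v = (\<Sum>b\<in>P0. d b *s b)"
        using span_coefficients[OF _ v] fin by (auto simp: P0_def)
      then have "q v = (\<Sum>b\<in>P0. (norm (d b))\<^sup>2 * q b)" using qsum[OF \<open>P0 \<subseteq> B\<close>] by blast
      then show ?thesis by (auto simp: P0_def intro!: sum_nonneg)
    qed
    ultimately show ?thesis
      unfolding nonneg_on_def q using vec.subspace_span by blast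
  next
    case False
    then have "card P0 \<le> k - 1" "k - 1 \<le> card B" using k cardB by auto
    moreover have "P0 \<subseteq> B" by (auto simp: P0_def)
    ultimately obtain X where X: "P0 \<subseteq> X" "X \<subseteq> B" "card X = k - 1"
      using exists_subset_between[of P0 "k - 1" B] fin by blast
    have finX: "finite X" "finite (B - X)" using X fin finite_subset by auto
    have neg: "q b < 0" if "b \<in> B - X" for b using that X(1) by (force simp: P0_def)
    let ?U = "vec.span X"
    have dimU: "vec.dim ?U = k - 1"
      using X B(1) vec.independent_mono vec.dim_span_eq_card_independent by metis
    obtain P where P: "projects_onto P ?U" using proj_exists[OF vec.subspace_span] .
    then have Pk: "P \<in> orth_projections (k - 1)"
      using projects_onto_imp_orth_projection[OF vec.subspace_span P] dimU by simp
    define \<xi> where "\<xi> = Arg2pi (- cnj w)"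
    have \<xi>: "\<xi> \<in> {0..<2 * pi}" "exp (\<i> * of_real \<xi>) = - cnj w"
      using Arg2pi[of "- cnj w"] w by (auto simp: \<xi>_def is_Arg_def)
    obtain x where x: "cinner_vec x x = 1" "c = cinner_vec ((A + perturbation A \<xi> P) *v x) x"
      using num[OF \<xi>(1) Pk] by (auto simp: num_range_def)
    obtain d where d: "x = (\<Sum>b\<in>B. d b *s b)"
      using span_coefficients[OF fin, of x] B(2) by auto
    define u where "u = (\<Sum>b\<in>X. d b *s b)"
    define v where "v = (\<Sum>b\<in>B - X. d b *s b)"
    have xuv: "x = u + v"
      unfolding d u_def v_def using X(2) fin by (simp add: sum.subset_diff add.commute)
    have uU: "u \<in> ?U" unfolding u_def by (intro vec.span_sum vec.span_scale vec.span_base)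
    have "cinner_vec v b = 0" if "b \<in> X" for b
      unfolding v_def cinner_sum_left cinner_scale_left using that X(2) orth
      by (intro sum.neutral ballI) force
    then have "v \<in> perp X" by (simp add: perp_def)
    then have vperp: "v \<in> perp ?U" by (simp add: perp_span)
    then have uv: "cinner_vec u v = 0" "cinner_vec v u = 0"
      using uU cinner_eq_0_commute by (auto simp: perp_def)
    have Px: "P *v x = u"
      using P uU vperp by (simp add: xuv projects_onto_def matrix_vector_right_distrib)
    have "(norm x)\<^sup>2 = 1" using x(1) unfolding cinner_self of_real_eq_1_iff .
    then have normx: "norm x = 1" using norm_ge_zero[of x] unfolding power2_eq_1_iff by linarith
    have "c = cinner_vec (A *v x) x + 2 * (- cnj w) * of_real (opnorm A) * of_real ((norm u)\<^sup>2)"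
      unfolding x(2) perturbation_def \<xi>(2)
      by (simp add: matrix_vector_mult_add_rdistrib scale_matrix_vec cinner_simps Px)
        (simp add: xuv cinner_simps uv cinner_self)
    from arg_cong[OF this, of "\<lambda>a. w * a"]
    have "w * c = w * cinner_vec (A *v x) x
        - (w * cnj w) * of_real (2 * opnorm A * (norm u)\<^sup>2)"
      by (simp only: of_real_mult of_real_numeral) (simp add: algebra_simps)
    also have "w * cnj w = 1" using w complex_norm_square[of w] by simp
    finally have L: "L = Re (w * cinner_vec (A *v x) x) - 2 * opnorm A * (norm u)\<^sup>2"
      unfolding L_def by (simp only: minus_complex.sel mult_1_left Re_complex_of_real)
    have "q x = 2 * opnorm A * (norm u)\<^sup>2" using L normx by (simp add: q_def)
    moreover have "q x = q u + q v"
      unfolding d u_def v_def using qsum[of B] qsum[of X] qsum[of "B - X"] X(2) fin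
      by (simp add: sum.subset_diff[of X B])
    moreover have "q u \<le> opnorm A * (norm u)\<^sup>2 - L * (norm u)\<^sup>2"
      using form_bound[OF w, of A u] by (simp add: q_def)
    ultimately have qv: "(opnorm A + L) * (norm u)\<^sup>2 \<le> q v" by (simp add: algebra_simps)
    have "card X < card B" using X(3) k cardB by simp
    then obtain b where b: "b \<in> B - X" using X(2) by (metis Diff_eq_empty_iff all_not_in_conv less_irrefl subset_antisym)
    have AL: "0 < opnorm A + L"
    proof -
      have "b \<noteq> 0" using b B(1) vec.dependent_zero by blast
      have "- (opnorm A * (norm b)\<^sup>2) < L * (norm b)\<^sup>2"
        using neg[OF b] form_bound[OF w, of A b] by (simp add: q_def)
      then have "0 < (opnorm A + L) * (norm b)\<^sup>2" by (simp add: algebra_simps)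
      then show ?thesis using \<open>b \<noteq> 0\<close> by (simp add: zero_less_mult_iff)
    qed
    have qv': "q v = (\<Sum>b\<in>B - X. (norm (d b))\<^sup>2 * q b)" unfolding v_def by (rule qsum) blast
    have nonpos: "(norm (d b))\<^sup>2 * q b \<le> 0" if "b \<in> B - X" for b
      using neg[OF that] by (simp add: mult_nonneg_nonpos)
    have "0 \<le> q v" using qv AL by (smt (verit) mult_nonneg_nonneg zero_le_power2)
    moreover have "q v \<le> 0" unfolding qv' using nonpos by (rule sum_nonpos)
    ultimately have qv0: "q v = 0" by simp
    have "d b = 0" if "b \<in> B - X" for b
    proof -
      have "(\<Sum>b\<in>B - X. - ((norm (d b))\<^sup>2 * q b)) = 0" using qv0 qv' by (simp add: sum_negf)
      then have "- ((norm (d b))\<^sup>2 * q b) = 0"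
        using sum_nonneg_eq_0_iff[OF finX(2), of "\<lambda>b. - ((norm (d b))\<^sup>2 * q b)"] nonpos that by auto
      then show ?thesis using neg[OF that] by auto
    qed
    then have "v = 0" by (simp add: v_def)
    moreover have "u = 0" using qv AL qv0 by (simp add: mult_le_0_iff)
    ultimately show ?thesis using xuv normx by simp
  qed
qed

section \<open>The intersection formulas\<close>

lemma num_rangeI:
  assumes "x \<noteq> 0" "cinner_vec (M *v x) x = c * cinner_vec x x"
  shows "c \<in> num_range M"
proof -
  define y where "y = (1 / complex_of_real (norm x)) *s x"
  have "cinner_vec y y = 1" "cinner_vec (M *v y) y = c"
    unfolding y_def vector_scalar_commute cinner_scale_left cinner_scale_right assms(2)
    unfolding cinner_self using assms(1) by (simp_all add: power2_eq_square)
  then show ?thesis by (auto simp: num_range_def)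
qed

lemma perturbation_vec: "perturbation A \<xi> P *v x = (2 * exp (\<i> * of_real \<xi>) * of_real (opnorm A)) *s (P *v x)"
  by (simp add: perturbation_def scale_matrix_vec)

lemma rank_perturbation:
  fixes A :: "complex^'n^'n"
  assumes "P \<in> orth_projections r"
  shows "rank (perturbation A \<xi> P) \<le> r"
proof -
  have "vec.dim {x. P *v x = 0} \<le> vec.dim {x. perturbation A \<xi> P *v x = 0}"
    by (rule vec.dim_subset) (auto simp: perturbation_vec)
  moreover have "rank P = r" using assms by (simp add: orth_projections_def)
  ultimately show ?thesis
    using dim_kernel[of P] dim_kernel[of "perturbation A \<xi> P"] by linarith
qed

lemma higher_rank_range_of_num_ranges:
  fixes A :: "complex^'n^'n"
  assumes "1 \<le> k" "k \<le> CARD('n)"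
    and "\<And>\<xi> P. \<xi> \<in> {0..<2 * pi} \<Longrightarrow> P \<in> orth_projections (k - 1) \<Longrightarrow>
      c \<in> num_range (A + perturbation A \<xi> P)"
  shows "c \<in> higher_rank_range k A"
proof -
  let ?D = "A - scale_matrix c (mat 1)"
  have "generically_nonneg ?D UNIV k"
    unfolding generically_nonneg_def using nonneg_subspace_of_num_ranges[OF assms] by (intro exI[of _ "{}"]) auto
  then obtain V where V: "vec.subspace V" "vec.dim V = k" "scalar_on ?D 0 V"
    using isotropic_subspace_exists[OF vec.subspace_UNIV] by blast
  have "scalar_on A c V"
    using V(3) by (simp add: scalar_on_def matrix_vector_mult_diff_rdistrib scale_matrix_vec cinner_simps)
  then show ?thesis using V higher_rank_range_iff by blast
qed

text \<open>Take for \<open>Q\<close> the projection onto an \<open>r\<close>-dimensional subspace of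
  the range of \<open>P\<close>. Then \<open>P\<close> and \<open>Q\<close> agree on a subspace of
  codimension \<open>k - 1 - r\<close>, namely the smaller range together with the kernel of
  \<open>P\<close>, and this subspace meets every subspace of dimension \<open>k - r\<close>
  nontrivially.\<close>
lemma num_range_of_higher_rank_range:
  fixes A :: "complex^'n^'n"
  assumes r: "r < k" and P: "P \<in> orth_projections (k - 1)"
    and hr: "\<And>Q. Q \<in> orth_projections r \<Longrightarrow> c \<in> higher_rank_range (k - r) (A + perturbation A \<xi> Q)"
  shows "c \<in> num_range (A + perturbation A \<xi> P)"
proof -
  obtain U where U: "vec.subspace U" "vec.dim U = k - 1" "projects_onto P U"
    using orth_projection_projects_onto[OF P] .
  have "r \<le> vec.dim U" using U(2) r by simp
  then obtain U1 where U1: "vec.subspace U1" "U1 \<subseteq> U" "vec.dim U1 = r"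
    using subspace_of_dim[OF U(1)] by blast
  obtain Q where Q: "projects_onto Q U1" using proj_exists[OF U1(1)] .
  then have "Q \<in> orth_projections r" using projects_onto_imp_orth_projection[OF U1(1) Q] U1(3) by simp
  then obtain V where V: "vec.subspace V" "vec.dim V = k - r" "scalar_on (A + perturbation A \<xi> Q) c V"
    using hr higher_rank_range_iff by blast
  let ?K = "{x. (P - Q) *v x = 0}"
  have "U1 \<inter> perp U \<subseteq> {0}"
  proof
    fix x assume "x \<in> U1 \<inter> perp U"
    then have "cinner_vec x x = 0" using U1(2) unfolding perp_def by blast
    then show "x \<in> {0}" by simp
  qed
  then have "vec.dim (U1 \<inter> perp U) = 0" by simp
  moreover have "vec.dim {x + y |x y. x \<in> U1 \<and> y \<in> perp U} \<le> vec.dim ?K"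
  proof (rule vec.dim_subset, clarify)
    fix x y assume "x \<in> U1" "y \<in> perp U"
    moreover have "y \<in> perp U1" using \<open>y \<in> perp U\<close> U1(2) by (auto simp: perp_def)
    ultimately show "(P - Q) *v (x + y) = 0"
      using U(3) Q U1(2) by (auto simp: projects_onto_def matrix_vector_mult_diff_rdistrib matrix_vector_right_distrib)
  qed
  ultimately have "r + vec.dim (perp U) \<le> vec.dim ?K"
    using vec.dim_sums_Int[OF U1(1) subspace_perp, of U] U1(3) by linarith
  then have "vec.dim (V \<inter> ?K) \<noteq> 0"
    using dim_Int_ge[OF V(1) subspace_kernel, of "P - Q"] dim_perp[of U] U(2) V(2) r by linarith
  then obtain x where x: "x \<in> V" "(P - Q) *v x = 0" "x \<noteq> 0" by auto
  have "P *v x = Q *v x" using x(2) by (simp add: matrix_vector_mult_diff_rdistrib)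
  then have "cinner_vec ((A + perturbation A \<xi> P) *v x) x = cinner_vec ((A + perturbation A \<xi> Q) *v x) x"
    by (simp add: matrix_vector_mult_add_rdistrib perturbation_vec)
  also have "\<dots> = c * cinner_vec x x" using V(3) x(1) by (simp add: scalar_on_def)
  finally show ?thesis using x(3) by (intro num_rangeI)
qed

lemma higher_rank_range_eq_Inter:
  fixes A :: "complex^'n^'n"
  assumes r: "r < k" "k \<le> CARD('n)" and S: "S \<subseteq> rank_le_matrices r"
    and S0: "{perturbation A \<xi> P | P \<xi>. P \<in> orth_projections r \<and> \<xi> \<in> {0..<2 * pi}} \<subseteq> S"
  shows "higher_rank_range k A = (\<Inter>F\<in>S. higher_rank_range (k - r) (A + F))"
proof
  show "higher_rank_range k A \<subseteq> (\<Inter>F\<in>S. higher_rank_range (k - r) (A + F))"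
    using S higher_rank_range_perturb by (fastforce simp: rank_le_matrices_def)
  show "(\<Inter>F\<in>S. higher_rank_range (k - r) (A + F)) \<subseteq> higher_rank_range k A"
  proof
    fix c assume c: "c \<in> (\<Inter>F\<in>S. higher_rank_range (k - r) (A + F))"
    show "c \<in> higher_rank_range k A"
    proof (rule higher_rank_range_of_num_ranges)
      fix \<xi> and P :: "complex^'n^'n"
      assume \<xi>: "\<xi> \<in> {0..<2 * pi}" and P: "P \<in> orth_projections (k - 1)"
      show "c \<in> num_range (A + perturbation A \<xi> P)"
      proof (rule num_range_of_higher_rank_range[OF r(1) P])
        fix Q :: "complex^'n^'n" assume "Q \<in> orth_projections r"
        then have "perturbation A \<xi> Q \<in> S" using S0 \<xi> by blast
        then show "c \<in> higher_rank_range (k - r) (A + perturbation A \<xi> Q)" using c by blast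
      qed
    qed (use r in auto)
  qed
qed

theorem theorem3p4:
  fixes A :: "complex^'n^'n" and r k :: nat and S :: "(complex^'n^'n) set"
  assumes "1 \<le> r" and "r < k" and "k \<le> CARD('n)"
    and "S \<subseteq> rank_le_matrices r"
    and "{perturbation A \<xi> P | P \<xi>. P \<in> orth_projections r \<and> \<xi> \<in> {0..<2 * pi}} \<subseteq> S"
  shows "higher_rank_range k A = (\<Inter>F\<in>S. higher_rank_range (k - r) (A + F))
    \<and> higher_rank_range k A =
        (\<Inter>\<xi>\<in>{0..<2 * pi}. \<Inter>P\<in>orth_projections 1.
           higher_rank_range (k - 1) (A + perturbation A \<xi> P))
    \<and> higher_rank_range k A =
        (\<Inter>\<xi>\<in>{0..<2 * pi}. \<Inter>P\<in>orth_projections (k - 1).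
           num_range (A + perturbation A \<xi> P))"
proof (intro conjI)
  show "higher_rank_range k A = (\<Inter>F\<in>S. higher_rank_range (k - r) (A + F))"
    using assms by (intro higher_rank_range_eq_Inter)
  have "higher_rank_range k A = (\<Inter>F\<in>{perturbation A \<xi> P | P \<xi>. P \<in> orth_projections 1 \<and> \<xi> \<in> {0..<2 * pi}}.
      higher_rank_range (k - 1) (A + F))"
    using assms(1-3) rank_perturbation
    by (intro higher_rank_range_eq_Inter) (auto simp: rank_le_matrices_def)
  also have "\<dots> = (\<Inter>\<xi>\<in>{0..<2 * pi}. \<Inter>P\<in>orth_projections 1.
      higher_rank_range (k - 1) (A + perturbation A \<xi> P))"
    by blast
  finally show "higher_rank_range k A = (\<Inter>\<xi>\<in>{0..<2 * pi}. \<Inter>P\<in>orth_projections 1.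
      higher_rank_range (k - 1) (A + perturbation A \<xi> P))" .
  show "higher_rank_range k A = (\<Inter>\<xi>\<in>{0..<2 * pi}. \<Inter>P\<in>orth_projections (k - 1).
      num_range (A + perturbation A \<xi> P))"
  proof
    show "(\<Inter>\<xi>\<in>{0..<2 * pi}. \<Inter>P\<in>orth_projections (k - 1). num_range (A + perturbation A \<xi> P))
        \<subseteq> higher_rank_range k A"
      using assms(1-3) higher_rank_range_of_num_ranges[of k _ A] by auto
    show "higher_rank_range k A \<subseteq>
        (\<Inter>\<xi>\<in>{0..<2 * pi}. \<Inter>P\<in>orth_projections (k - 1). num_range (A + perturbation A \<xi> P))"
    proof (intro subsetI INT_I)
      fix c \<xi> and P :: "complex^'n^'n"
      assume "c \<in> higher_rank_range k A" "P \<in> orth_projections (k - 1)"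
      then have "c \<in> higher_rank_range (k - (k - 1)) (A + perturbation A \<xi> P)"
        using rank_perturbation higher_rank_range_perturb by blast
      then have "\<exists>V. vec.subspace V \<and> vec.dim V = 1 \<and> scalar_on (A + perturbation A \<xi> P) c V"
        using assms(1,2) by (simp add: higher_rank_range_iff)
      then obtain V where V: "vec.dim V = 1" "scalar_on (A + perturbation A \<xi> P) c V" by blast
      have "\<not> V \<subseteq> {0}"
      proof
        assume "V \<subseteq> {0}"
        then have "vec.dim V = 0" by simp
        then show False using V(1) by simp
      qed
      then obtain x where x: "x \<in> V" "x \<noteq> 0" by blast
      then show "c \<in> num_range (A + perturbation A \<xi> P)"
        using V(2) by (intro num_rangeI[of x]) (auto simp: scalar_on_def)
    qed
  qed
qed

end
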